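(* Let $n\ge 1$. For each complete exceptional sequence $(E_1,\dots,E_n)$ for the linearly oriented quiver of type $A_n$, consider the partial ordering on the set $\{v_1,\dots,v_n\}$ given by $v_i< v_j$ if and only if the support of $E_i$ is properly contained in the support of $E_j$. Then the Hasse diagram of this poset is a rooted labeled forest (with the maximal elements as roots). Conversely, any rooted forest with $n$ vertices labeled $v_1,\dots,v_n$ is the Hasse diagram, in this sense, of a unique (up to isomorphism of the terms) complete exceptional sequence.
   Context: Let $K$ be a field, $Q: 1\to 2\to\cdots\to n$ the linearly oriented quiver of type $A_n$, $\Lambda=KQ$. $\Lambda$-modules are finite-dimensional representations of $Q$ over $K$. The indecomposable modules are, up to isomorphism, the $M_{ab}$, $1\le a\le b\le n$, where $M_{ab}$ has $K$ at the vertices $a,a+1,\dots,b$, identity maps between them, and $0$ elsewhere; its support is the interval $[a,b]$, its top is the simple at $a$ and its socle is the simple at $b$. $\mathrm{Ext}$ means $\mathrm{Ext}^1_\Lambda$. A complete exceptional sequence is a sequence $(E_1,\dots,E_n)$ of rigid (i.e. $\mathrm{Ext}(E_i,E_i)=0$) indecomposable modules such that $\mathrm{Hom}(E_j,E_i)=0=\mathrm{Ext}(E_j,E_i)$ for all $1\le i<j\le n$. Such sequences are considered up to isomorphism of their terms. A rooted labeled forest with $n$ vertices is a forest with vertices labeled $v_1,\dots,v_n$ together with a chosen root in each component. Its vertices are partially ordered by $v_i\le v_j$ iff $v_j$ lies on the path from $v_i$ to the root of its component; the forest is the Hasse diagram of this order, with the roots as maximal elements. *)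

theory Defs
  imports Complex_Main "HOL-Library.Function_Algebras"
begin

section \<open>Finite-dimensional vector spaces over a field\<close>

text \<open>Finite-dimensional vector spaces over the field \<open>'k\<close> are realised as finite-dimensional
  subspaces of the sequence space \<open>nat \<Rightarrow> 'k\<close>, which contains spaces of every finite dimension.
  So every finite-dimensional representation is isomorphic to one considered here, and
  the quantification over middle terms of extensions below loses nothing.\<close>

definition vscale :: "'k::field \<Rightarrow> (nat \<Rightarrow> 'k) \<Rightarrow> nat \<Rightarrow> 'k" where
  "vscale c v = (\<lambda>i. c * v i)"

global_interpretation seqspace: vector_space "vscale :: 'k::field \<Rightarrow> (nat \<Rightarrow> 'k) \<Rightarrow> nat \<Rightarrow> 'k"
  by unfold_locales (auto simp: vscale_def fun_eq_iff algebra_simps)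

definition fd_space :: "(nat \<Rightarrow> 'k::field) set \<Rightarrow> bool" where
  "fd_space V \<longleftrightarrow> (\<exists>B. finite B \<and> V = seqspace.span B)"

definition linear_on ::
  "(nat \<Rightarrow> 'k::field) set \<Rightarrow> (nat \<Rightarrow> 'k) set \<Rightarrow> ((nat \<Rightarrow> 'k) \<Rightarrow> nat \<Rightarrow> 'k) \<Rightarrow> bool" where
  "linear_on V W f \<longleftrightarrow> f ` V \<subseteq> W \<and>
     (\<forall>x\<in>V. \<forall>y\<in>V. f (x + y) = f x + f y) \<and>
     (\<forall>c. \<forall>x\<in>V. f (vscale c x) = vscale c (f x))"


section \<open>Representations of the quiver \<open>1 \<rightarrow> 2 \<rightarrow> \<dots> \<rightarrow> n\<close>\<close>

text \<open>\<open>vspace M i\<close> is the vector space at vertex \<open>i\<close> and \<open>arr M i\<close> the map along \<open>i \<rightarrow> i + 1\<close>.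
  Only the spaces at \<open>1, \<dots>, n\<close>, and the maps restricted to these spaces, are relevant. The same
  holds for the components \<open>f i\<close> of a morphism, so that morphisms are only ever
  compared pointwise on the spaces at the vertices.\<close>

record 'k rep =
  vspace :: "nat \<Rightarrow> (nat \<Rightarrow> 'k) set"
  arr :: "nat \<Rightarrow> (nat \<Rightarrow> 'k) \<Rightarrow> nat \<Rightarrow> 'k"

type_synonym 'k rep_map = "nat \<Rightarrow> (nat \<Rightarrow> 'k) \<Rightarrow> nat \<Rightarrow> 'k"

definition representation :: "nat \<Rightarrow> 'k::field rep \<Rightarrow> bool" where
  "representation n M \<longleftrightarrow>
     (\<forall>i\<in>{1..n}. fd_space (vspace M i)) \<and>
     (\<forall>i\<in>{1..<n}. linear_on (vspace M i) (vspace M (i + 1)) (arr M i))"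

definition morphism :: "nat \<Rightarrow> 'k::field rep \<Rightarrow> 'k rep \<Rightarrow> 'k rep_map \<Rightarrow> bool" where
  "morphism n M N f \<longleftrightarrow>
     (\<forall>i\<in>{1..n}. linear_on (vspace M i) (vspace N i) (f i)) \<and>
     (\<forall>i\<in>{1..<n}. \<forall>x\<in>vspace M i. f (i + 1) (arr M i x) = arr N i (f i x))"

definition isomorphic :: "nat \<Rightarrow> 'k::field rep \<Rightarrow> 'k rep \<Rightarrow> bool" where
  "isomorphic n M N \<longleftrightarrow>
     (\<exists>f. morphism n M N f \<and> (\<forall>i\<in>{1..n}. bij_betw (f i) (vspace M i) (vspace N i)))"

definition rep_support :: "nat \<Rightarrow> 'k::field rep \<Rightarrow> nat set" where
  "rep_support n M = {i\<in>{1..n}. vspace M i \<noteq> {0}}"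

definition subrep :: "nat \<Rightarrow> 'k::field rep \<Rightarrow> (nat \<Rightarrow> (nat \<Rightarrow> 'k) set) \<Rightarrow> bool" where
  "subrep n M U \<longleftrightarrow>
     (\<forall>i\<in>{1..n}. seqspace.subspace (U i) \<and> U i \<subseteq> vspace M i) \<and>
     (\<forall>i\<in>{1..<n}. arr M i ` U i \<subseteq> U (i + 1))"

definition direct_sum_decomposition ::
  "nat \<Rightarrow> 'k::field rep \<Rightarrow> (nat \<Rightarrow> (nat \<Rightarrow> 'k) set) \<Rightarrow> (nat \<Rightarrow> (nat \<Rightarrow> 'k) set) \<Rightarrow> bool" where
  "direct_sum_decomposition n M U W \<longleftrightarrow> subrep n M U \<and> subrep n M W \<and>
     (\<forall>i\<in>{1..n}. U i \<inter> W i = {0} \<and> vspace M i = {u + w |u w. u \<in> U i \<and> w \<in> W i})"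

definition indecomposable :: "nat \<Rightarrow> 'k::field rep \<Rightarrow> bool" where
  "indecomposable n M \<longleftrightarrow>
     (\<exists>i\<in>{1..n}. vspace M i \<noteq> {0}) \<and>
     (\<forall>U W. direct_sum_decomposition n M U W \<longrightarrow>
        (\<forall>i\<in>{1..n}. U i = {0}) \<or> (\<forall>i\<in>{1..n}. W i = {0}))"

definition Hom_zero :: "nat \<Rightarrow> 'k::field rep \<Rightarrow> 'k rep \<Rightarrow> bool" where
  "Hom_zero n M N \<longleftrightarrow> (\<forall>f. morphism n M N f \<longrightarrow> (\<forall>i\<in>{1..n}. \<forall>x\<in>vspace M i. f i x = 0))"

definition short_exact ::
  "nat \<Rightarrow> 'k::field rep \<Rightarrow> 'k rep_map \<Rightarrow> 'k rep \<Rightarrow> 'k rep_map \<Rightarrow> 'k rep \<Rightarrow> bool" where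
  "short_exact n N f X g M \<longleftrightarrow> morphism n N X f \<and> morphism n X M g \<and>
     (\<forall>i\<in>{1..n}. inj_on (f i) (vspace N i) \<and>
        f i ` vspace N i = {x\<in>vspace X i. g i x = 0} \<and>
        g i ` vspace X i = vspace M i)"

text \<open>\<open>Ext\<^sup>1(M, N)\<close> is the group of Yoneda classes of extensions \<open>0 \<rightarrow> N \<rightarrow> X \<rightarrow> M \<rightarrow> 0\<close>. Its zero
  element is the class of the split extensions, so it vanishes iff each such extension splits.\<close>

definition Ext_zero :: "nat \<Rightarrow> 'k::field rep \<Rightarrow> 'k rep \<Rightarrow> bool" where
  "Ext_zero n M N \<longleftrightarrow>
     (\<forall>X f g. representation n X \<and> short_exact n N f X g M \<longrightarrow>
        (\<exists>s. morphism n M X s \<and> (\<forall>i\<in>{1..n}. \<forall>x\<in>vspace M i. g i (s i x) = x)))"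

definition complete_exceptional_sequence :: "nat \<Rightarrow> (nat \<Rightarrow> 'k::field rep) \<Rightarrow> bool" where
  "complete_exceptional_sequence n E \<longleftrightarrow>
     (\<forall>i\<in>{1..n}. representation n (E i) \<and> indecomposable n (E i) \<and> Ext_zero n (E i) (E i)) \<and>
     (\<forall>i\<in>{1..n}. \<forall>j\<in>{1..n}. i < j \<longrightarrow> Hom_zero n (E j) (E i) \<and> Ext_zero n (E j) (E i))"


section \<open>Hasse diagrams and rooted forests\<close>

definition covered_by :: "'a set \<Rightarrow> ('a \<Rightarrow> 'a \<Rightarrow> bool) \<Rightarrow> 'a \<Rightarrow> 'a \<Rightarrow> bool" where
  "covered_by V lt x y \<longleftrightarrow> x \<in> V \<and> y \<in> V \<and> lt x y \<and> \<not> (\<exists>z\<in>V. lt x z \<and> lt z y)"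

definition hasse_edges :: "'a set \<Rightarrow> ('a \<Rightarrow> 'a \<Rightarrow> bool) \<Rightarrow> 'a set set" where
  "hasse_edges V lt = {{x, y} |x y. covered_by V lt x y}"

definition maximal_elements :: "'a set \<Rightarrow> ('a \<Rightarrow> 'a \<Rightarrow> bool) \<Rightarrow> 'a set" where
  "maximal_elements V lt = {x\<in>V. \<not> (\<exists>y\<in>V. lt x y)}"

definition simple_graph :: "'a set \<Rightarrow> 'a set set \<Rightarrow> bool" where
  "simple_graph V F \<longleftrightarrow> (\<forall>e\<in>F. \<exists>x\<in>V. \<exists>y\<in>V. x \<noteq> y \<and> e = {x, y})"

definition graph_cycle :: "'a set set \<Rightarrow> 'a list \<Rightarrow> bool" where
  "graph_cycle F xs \<longleftrightarrow> length xs \<ge> 3 \<and> distinct xs \<and>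
     (\<forall>k<length xs. {xs ! k, xs ! ((k + 1) mod length xs)} \<in> F)"

definition graph_connected :: "'a set set \<Rightarrow> 'a \<Rightarrow> 'a \<Rightarrow> bool" where
  "graph_connected F x y \<longleftrightarrow> (x, y) \<in> {(u, v). {u, v} \<in> F}\<^sup>*"

text \<open>\<open>F\<close> is the set of edges and \<open>R\<close> the set of roots, one in each component.\<close>

definition rooted_forest :: "'a set \<Rightarrow> 'a set set \<Rightarrow> 'a set \<Rightarrow> bool" where
  "rooted_forest V F R \<longleftrightarrow> simple_graph V F \<and> \<not> (\<exists>xs. graph_cycle F xs) \<and>
     R \<subseteq> V \<and> (\<forall>v\<in>V. \<exists>!r. r \<in> R \<and> graph_connected F v r)"


section \<open>The poset of an exceptional sequence\<close>

text \<open>The label \<open>v\<^sub>i\<close> is represented by its index \<open>i\<close>.\<close>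

definition support_less :: "nat \<Rightarrow> (nat \<Rightarrow> 'k::field rep) \<Rightarrow> nat \<Rightarrow> nat \<Rightarrow> bool" where
  "support_less n E i j \<longleftrightarrow> rep_support n (E i) \<subset> rep_support n (E j)"

definition has_hasse_diagram :: "nat \<Rightarrow> (nat \<Rightarrow> 'k::field rep) \<Rightarrow> nat set set \<Rightarrow> nat set \<Rightarrow> bool" where
  "has_hasse_diagram n E F R \<longleftrightarrow>
     hasse_edges {1..n} (support_less n E) = F \<and>
     maximal_elements {1..n} (support_less n E) = R"

end

theory Submission imports Defs begin

text \<open>An indecomposable representation is an interval module, because the submodule generated by a
  nonzero element at the first vertex of the support is always a direct summand. For interval modules
  \<open>Hom(M\<^sub>a\<^sub>b, M\<^sub>c\<^sub>d) \<noteq> 0\<close> iff \<open>c \<le> a \<le> d \<le> b\<close>, and \<open>Ext(M\<^sub>a\<^sub>b, M\<^sub>c\<^sub>d) \<noteq> 0\<close> iff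
  \<open>a < c \<le> b + 1 \<le> d\<close>. Hence the supports in an exceptional sequence are pairwise disjoint or strictly
  nested, a subinterval sharing the left (right) endpoint of a larger one comes later (earlier) than it,
  and of two adjacent intervals the left one comes first. So the maximal proper subintervals never cover
  an interval, every interval has a point of its own, and, there being \<open>n\<close> intervals on \<open>n\<close>
  points, exactly one. To the left of this point the children of \<open>v\<close> have labels larger than \<open>v\<close>, to
  the right smaller ones, and on each side the labels increase. Thus the labelled forest determines
  the linear order of these points, and the interval of \<open>v\<close> is the set of the points of its
  descendants; conversely this recipe turns each labelled forest into an exceptional sequence.
  A forest is made a tree by adding the root 0 with interval \<open>[1, n + 1]\<close>.\<close>


section \<open>Interval modules\<close>

text \<open>The artificial root obeys the same inequalities as the genuine terms: against a later
  interval inside \<open>[1, n]\<close>, a failure of the Hom condition would force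
  \<open>n + 1 \<le> n\<close>, and a failure of the Ext condition a left endpoint below 1. Since 0
  is the smallest label, all its children go to the left of its point, which is therefore
  \<open>n + 1\<close>; the other points are the vertices of the quiver. Both directions meet in one
  formula: the interval of \<open>v\<close> is the image of \<open>downset v\<close> under
  \<open>pos\<close>, and \<open>pos\<close> is computed from the labelled order alone. For given
  exceptional intervals this is a theorem, resting on the count of points, and uniqueness is
  immediate from it. For a given tree it is the definition, and the work is to recover the Hom and
  Ext conditions: a common endpoint is treated by following labels along one branch, adjacency by
  looking at the vertex where two branches part. Hasse diagrams are undirected graphs here, so
  passing between a diagram and its order is a separate task, in which the roots supply the
  orientation.\<close>

lemma vscale_cancel [simp]: "vscale s v = vscale t v \<longleftrightarrow> s = t \<or> v = 0"
  by (rule seqspace.scale_cancel_right)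

lemma all_nat_split_0_1: "(\<forall>k::nat. P k) \<longleftrightarrow> P 0 \<and> P 1 \<and> (\<forall>k\<ge>2. P k)"
  by (metis One_nat_def less_2_cases not_le)

definition unit_vec :: "nat \<Rightarrow> nat \<Rightarrow> 'k::field" where
  "unit_vec k = (\<lambda>i. if i = k then 1 else 0)"

lemma unit_vec_nonzero: "unit_vec k \<noteq> 0"
  by (auto simp: unit_vec_def fun_eq_iff)

text \<open>The middle term of the non-split extension is built from coordinate subspaces; this is
  what makes them finite-dimensional.\<close>

lemma span_unit_vecs:
  assumes "finite K"
  shows "seqspace.span (unit_vec ` K) = {v :: nat \<Rightarrow> 'k::field. \<forall>k. k \<notin> K \<longrightarrow> v k = 0}"
  using assms
proof (induction K)
  case empty
  show ?case by (auto simp: fun_eq_iff)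
next
  case (insert k K)
  have "(\<exists>t. \<forall>j. j \<notin> K \<longrightarrow> v j = vscale t (unit_vec k) j) \<longleftrightarrow> (\<forall>j. j \<noteq> k \<and> j \<notin> K \<longrightarrow> v j = 0)"
    for v :: "nat \<Rightarrow> 'k::field"
    by (auto simp: vscale_def unit_vec_def intro: exI[of _ "v k"])
  then show ?case using insert.IH by (simp add: seqspace.span_insert)
qed

lemma fd_space_subspace: "fd_space V \<Longrightarrow> seqspace.subspace V"
  by (auto simp: fd_space_def)

lemma fd_space_0: "fd_space {0}"
  unfolding fd_space_def by (rule exI[of _ "{}"]) auto

lemma fd_space_line: "fd_space (range (\<lambda>t. vscale t v))"
  unfolding fd_space_def by (rule exI[of _ "{v}"]) (simp add: seqspace.span_singleton)

lemma linear_onI: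
  assumes "\<And>x. x \<in> V \<Longrightarrow> f x \<in> W"
    and "\<And>x y. x \<in> V \<Longrightarrow> y \<in> V \<Longrightarrow> f (x + y) = f x + f y"
    and "\<And>c x. x \<in> V \<Longrightarrow> f (vscale c x) = vscale c (f x)"
  shows "linear_on V W f"
  using assms by (auto simp: linear_on_def)

lemma
  assumes "linear_on V W f"
  shows linear_on_in: "x \<in> V \<Longrightarrow> f x \<in> W"
    and linear_on_add: "x \<in> V \<Longrightarrow> y \<in> V \<Longrightarrow> f (x + y) = f x + f y"
    and linear_on_scale: "x \<in> V \<Longrightarrow> f (vscale c x) = vscale c (f x)"
    and linear_on_0: "0 \<in> V \<Longrightarrow> f 0 = 0"
proof -
  show "x \<in> V \<Longrightarrow> f (vscale c x) = vscale c (f x)" for c x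
    using assms by (auto simp: linear_on_def)
  from this[of 0 0] show "0 \<in> V \<Longrightarrow> f 0 = 0" by simp
qed (use assms in \<open>auto simp: linear_on_def\<close>)

lemma
  assumes "representation n M"
  shows rep_subspace: "1 \<le> i \<Longrightarrow> i \<le> n \<Longrightarrow> seqspace.subspace (vspace M i)"
    and rep_linear: "1 \<le> i \<Longrightarrow> i < n \<Longrightarrow> linear_on (vspace M i) (vspace M (Suc i)) (arr M i)"
  using assms fd_space_subspace[of "vspace M i"] by (auto simp: representation_def)

lemma rep_0: "representation n M \<Longrightarrow> 1 \<le> i \<Longrightarrow> i \<le> n \<Longrightarrow> 0 \<in> vspace M i"
  using rep_subspace seqspace.subspace_0 by blast

lemma
  assumes "morphism n M N f"
  shows morphism_linear: "1 \<le> i \<Longrightarrow> i \<le> n \<Longrightarrow> linear_on (vspace M i) (vspace N i) (f i)"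
    and morphism_commute: "1 \<le> i \<Longrightarrow> i < n \<Longrightarrow> x \<in> vspace M i \<Longrightarrow> f (Suc i) (arr M i x) = arr N i (f i x)"
  using assms by (auto simp: morphism_def)

section \<open>Transport along paths and representations supported on an interval\<close>

primrec push :: "'k::field rep \<Rightarrow> nat \<Rightarrow> (nat \<Rightarrow> 'k) \<Rightarrow> nat \<Rightarrow> nat \<Rightarrow> 'k" where
  "push M a x 0 = x"
| "push M a x (Suc k) = arr M (a + k) (push M a x k)"

lemma push_arr: "push M (Suc i) (arr M i x) k = push M i x (Suc k)"
  by (induction k) auto

lemma push_push: "push M (a + k) (push M a x k) m = push M a x (k + m)"
  by (induction m) (auto simp: add.assoc)

lemma push_linear:
  assumes "representation n M" "1 \<le> a" "a + k \<le> n"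
  shows "linear_on (vspace M a) (vspace M (a + k)) (\<lambda>x. push M a x k)"
  using assms(3)
proof (induction k)
  case (Suc k)
  then have IH: "linear_on (vspace M a) (vspace M (a + k)) (\<lambda>x. push M a x k)" by simp
  have arr: "linear_on (vspace M (a + k)) (vspace M (Suc (a + k))) (arr M (a + k))"
    using rep_linear[OF assms(1)] assms(2) Suc.prems by simp
  show ?case
    using linear_on_in[OF IH] linear_on_add[OF IH] linear_on_scale[OF IH]
      linear_on_in[OF arr] linear_on_add[OF arr] linear_on_scale[OF arr]
    by (intro linear_onI) (simp_all only: push.simps add_Suc_right)
qed (auto intro: linear_onI)

lemma push_morphism:
  assumes "representation n M" "morphism n M N f" "1 \<le> a" "a + k \<le> n" "x \<in> vspace M a"
  shows "f (a + k) (push M a x k) = push N a (f a x) k"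
  using assms(4)
proof (induction k)
  case (Suc k)
  have "push M a x k \<in> vspace M (a + k)"
    using linear_on_in[OF push_linear[OF assms(1,3)]] Suc.prems assms(5) by simp
  then show ?case using Suc morphism_commute[OF assms(2), of "a + k"] assms(3) by simp
qed simp

text \<open>The module \<open>M_ab\<close> in an arbitrary basis: with the vectors
  \<open>e i\<close> kept free, the same lemmas serve the standard model and an abstract
  indecomposable. The arrow out of \<open>b\<close> lands in a zero space, whence
  \<open>arr_end\<close>.\<close>

locale interval_rep =
  fixes n :: nat and M :: "'k::field rep" and a b :: nat and e :: "nat \<Rightarrow> nat \<Rightarrow> 'k"
  assumes rep: "representation n M"
    and bounds: "1 \<le> a" "a \<le> b" "b \<le> n"
    and e_nonzero: "a \<le> i \<Longrightarrow> i \<le> b \<Longrightarrow> e i \<noteq> 0"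
    and vspace_inside: "a \<le> i \<Longrightarrow> i \<le> b \<Longrightarrow> vspace M i = range (\<lambda>t. vscale t (e i))"
    and vspace_outside: "1 \<le> i \<Longrightarrow> i \<le> n \<Longrightarrow> i < a \<or> b < i \<Longrightarrow> vspace M i = {0}"
    and arr_e: "a \<le> i \<Longrightarrow> i < b \<Longrightarrow> arr M i (e i) = e (Suc i)"
begin

definition coef :: "nat \<Rightarrow> (nat \<Rightarrow> 'k) \<Rightarrow> 'k" where
  "coef i x = (THE t. x = vscale t (e i))"

lemma coef_scale [simp]: "a \<le> i \<Longrightarrow> i \<le> b \<Longrightarrow> coef i (vscale t (e i)) = t"
  unfolding coef_def using e_nonzero by (auto intro: the_equality)

lemma coef_e [simp]: "a \<le> i \<Longrightarrow> i \<le> b \<Longrightarrow> coef i (e i) = 1"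
  using coef_scale[of i 1] by simp

lemma coef_0 [simp]: "a \<le> i \<Longrightarrow> i \<le> b \<Longrightarrow> coef i 0 = 0"
  using coef_scale[of i 0] by simp

lemma e_in: "a \<le> i \<Longrightarrow> i \<le> b \<Longrightarrow> e i \<in> vspace M i"
  using vspace_inside by (metis rangeI seqspace.scale_one)

lemma scale_e_in: "a \<le> i \<Longrightarrow> i \<le> b \<Longrightarrow> vscale t (e i) \<in> vspace M i"
  using vspace_inside by blast

lemma inside_cases:
  assumes "x \<in> vspace M i" "a \<le> i" "i \<le> b"
  obtains t where "x = vscale t (e i)"
  using assms vspace_inside by blast

lemma zero_in: "1 \<le> i \<Longrightarrow> i \<le> n \<Longrightarrow> 0 \<in> vspace M i"
  using rep rep_0 by blast

lemma arr_0: "1 \<le> i \<Longrightarrow> i < n \<Longrightarrow> arr M i 0 = 0"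
  using linear_on_0[OF rep_linear[OF rep]] zero_in by simp

lemma arr_scale_e: "a \<le> i \<Longrightarrow> i < b \<Longrightarrow> arr M i (vscale t (e i)) = vscale t (e (Suc i))"
  using linear_on_scale[OF rep_linear[OF rep], of i "e i" t] e_in[of i] arr_e[of i] bounds by simp

lemma arr_end:
  assumes "b < n" "x \<in> vspace M b" shows "arr M b x = 0"
  using linear_on_in[OF rep_linear[OF rep], of b x] assms vspace_outside[of "Suc b"] bounds by simp

text \<open>Each map out of an interval module constructed below is, at a vertex where it is
  nonzero, a coordinate times a fixed vector: the isomorphism, the nonzero homomorphism, the section
  and the inclusion into \<open>glue\<close>.\<close>

lemma coef_linear:
  assumes "seqspace.subspace W" "1 \<le> i" "i \<le> n" "a \<le> i" "i \<le> b" "w \<in> W"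
  shows "linear_on (vspace M i) W (\<lambda>x. vscale (coef i x) w)"
proof (rule linear_onI)
  fix x y c assume x: "x \<in> vspace M i"
  obtain t where t: "x = vscale t (e i)" using inside_cases[OF x assms(4,5)] .
  show "vscale (coef i x) w \<in> W" using assms by (simp add: seqspace.subspace_scale)
  show "vscale (coef i (vscale c x)) w = vscale c (vscale (coef i x) w)"
    using assms by (simp add: t)
  assume y: "y \<in> vspace M i"
  obtain s where s: "y = vscale s (e i)" using inside_cases[OF y assms(4,5)] .
  show "vscale (coef i (x + y)) w = vscale (coef i x) w + vscale (coef i y) w"
    using assms by (simp add: t s seqspace.scale_left_distrib[symmetric])
qed

lemma push_e: "a \<le> i \<Longrightarrow> i + k \<le> b \<Longrightarrow> push M i (vscale t (e i)) k = vscale t (e (i + k))"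
  by (induction k) (use arr_scale_e in auto)

lemma support: "rep_support n M = {a..b}"
proof -
  have "vspace M i \<noteq> {0}" if "a \<le> i" "i \<le> b" for i
    using e_in[OF that] e_nonzero[OF that] by blast
  then show ?thesis using vspace_outside bounds unfolding rep_support_def by force
qed

text \<open>The space at \<open>a\<close> is a line, so splitting \<open>e a\<close> puts a nonzero
  multiple of it into one summand. The arrows carry \<open>e a\<close> to all the other
  \<open>e i\<close>, so that summand is everything.\<close>

lemma indecomposable: "indecomposable n M"
  unfolding indecomposable_def
proof (intro conjI allI impI)
  show "\<exists>i\<in>{1..n}. vspace M i \<noteq> {0}"
    using e_in[of a] e_nonzero[of a] bounds by (intro bexI[of _ a]) auto
  have key: "\<forall>i\<in>{1..n}. W i = {0}"
    if d: "direct_sum_decomposition n M U W" and "e a \<in> U a" for U W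
  proof
    have U: "subrep n M U" and W: "subrep n M W"
      and UW: "\<And>i. i \<in> {1..n} \<Longrightarrow> U i \<inter> W i = {0}"
      using d by (auto simp: direct_sum_decomposition_def)
    have eU: "e i \<in> U i" if "a \<le> i" "i \<le> b" for i
      using that
    proof (induction i rule: dec_induct)
      case (step i)
      then have "i \<in> {1..<n}" using bounds by auto
      then have "arr M i ` U i \<subseteq> U (i + 1)" using U unfolding subrep_def by blast
      then show ?case using step arr_e[of i] by force
    qed (rule \<open>e a \<in> U a\<close>)
    fix i assume i: "i \<in> {1..n}"
    then have Wi: "seqspace.subspace (W i)" "W i \<subseteq> vspace M i" using W by (auto simp: subrep_def)
    have "w = 0" if w: "w \<in> W i" for w
    proof (cases "a \<le> i \<and> i \<le> b")
      case True
      then obtain t where t: "w = vscale t (e i)" using w Wi inside_cases by blast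
      have "w \<in> U i" using eU True U i by (auto simp: t subrep_def seqspace.subspace_scale)
      then show ?thesis using UW[OF i] w by blast
    next
      case False
      then show ?thesis using w Wi vspace_outside[of i] i by auto
    qed
    then show "W i = {0}" using seqspace.subspace_0[OF Wi(1)] by blast
  qed
  fix U W assume d: "direct_sum_decomposition n M U W"
  then have d': "direct_sum_decomposition n M W U"
    unfolding direct_sum_decomposition_def by (force simp: add.commute Int_commute)
  have a: "a \<in> {1..n}" using bounds by auto
  have "subrep n M U" "subrep n M W" using d by (simp_all add: direct_sum_decomposition_def)
  then have sub: "seqspace.subspace (U a)" "seqspace.subspace (W a)" "U a \<subseteq> vspace M a" "W a \<subseteq> vspace M a"
    using a by (simp_all only: subrep_def)
  have sum: "vspace M a = {u + w |u w. u \<in> U a \<and> w \<in> W a}"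
    using d unfolding direct_sum_decomposition_def by (elim conjE bspec[OF _ a, THEN conjunct2])
  have "e a \<in> {u + w |u w. u \<in> U a \<and> w \<in> W a}"
    using e_in[OF order.refl bounds(2)] by (simp only: sum)
  then obtain u w where uw: "e a = u + w" "u \<in> U a" "w \<in> W a" by blast
  obtain s where s: "u = vscale s (e a)"
    using inside_cases[OF _ order.refl bounds(2)] uw(2) sub(3) by blast
  obtain t where t: "w = vscale t (e a)"
    using inside_cases[OF _ order.refl bounds(2)] uw(3) sub(4) by blast
  have unscale: "e a \<in> S" if "seqspace.subspace S" "vscale c (e a) \<in> S" "c \<noteq> 0" for S c
    using seqspace.subspace_scale[OF that(1,2), of "inverse c"] that(3) by simp
  have "s \<noteq> 0 \<or> t \<noteq> 0" using uw(1) s t e_nonzero[of a] bounds by auto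
  then have "e a \<in> U a \<or> e a \<in> W a"
    using unscale[OF sub(1), of s] unscale[OF sub(2), of t] uw(2,3) s t by blast
  then show "(\<forall>i\<in>{1..n}. U i = {0}) \<or> (\<forall>i\<in>{1..n}. W i = {0})" using key d d' by blast
qed

end

text \<open>A complement of the submodule \<open>U\<close> generated by \<open>x\<close> is the
  kernel of a functional: carry a vector forward to \<open>b\<close> and read off a coordinate in
  which the generator survives. This is compatible with the arrows and nonzero on every
  \<open>e i\<close>. Outside \<open>[a, b]\<close> the complement is the whole space.\<close>

lemma indecomposable_interval_rep:
  fixes M :: "'k::field rep"
  assumes rep: "representation n M" and indec: "indecomposable n M"
  shows "\<exists>a b e. interval_rep n M a b e"
proof -
  define a where "a = (LEAST i. i \<in> {1..n} \<and> vspace M i \<noteq> {0})"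
  have "\<exists>i. i \<in> {1..n} \<and> vspace M i \<noteq> {0}" using indec unfolding indecomposable_def by blast
  then have a: "a \<in> {1..n}" "vspace M a \<noteq> {0}" and below: "\<And>i. i \<in> {1..n} \<Longrightarrow> i < a \<Longrightarrow> vspace M i = {0}"
    using LeastI_ex[of "\<lambda>i. i \<in> {1..n} \<and> vspace M i \<noteq> {0}"] not_less_Least
    unfolding a_def by blast+
  obtain x where x: "x \<in> vspace M a" "x \<noteq> 0" using a rep_0[OF rep, of a] by auto
  \<comment> \<open>\<open>P k\<close> says that the path of length \<open>k\<close> cannot be
    prolonged with nonzero image: it has reached vertex \<open>n\<close>, or the next arrow kills
    the vector. For the least such \<open>k\<close> the interval has \<open>k + 1\<close>
    vertices.\<close>
  define P where "P k \<longleftrightarrow> n \<le> a + k \<or> push M a x (Suc k) = 0" for k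
  define m where "m = (LEAST k. P k)"
  define b where "b = a + m"
  define e where "e i = push M a x (i - a)" for i
  have "P (n - a)" using a by (simp add: P_def)
  then have Pm: "P m" and m: "m \<le> n - a" and less: "\<And>k. k < m \<Longrightarrow> \<not> P k"
    unfolding m_def by (auto intro: LeastI Least_le dest: not_less_Least)
  have b: "a \<le> b" "b \<le> n" using a m by (auto simp: b_def)
  have nonzero: "push M a x k \<noteq> 0" if "k \<le> m" for k
    using that x less[of "k - 1"] by (cases k) (auto simp: P_def)
  have e_0: "e i \<noteq> 0" if "a \<le> i" "i \<le> b" for i
    using nonzero that by (auto simp: e_def b_def)
  have e_in: "e i \<in> vspace M i" if "a \<le> i" "i \<le> b" for i
    using linear_on_in[OF push_linear[OF rep, of a "i - a"] x(1)] a b that by (simp add: e_def)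
  have arr_e: "arr M i (e i) = e (Suc i)" if "a \<le> i" for i
    using that by (simp add: e_def Suc_diff_le)
  have arr_b: "arr M b (e b) = 0" if "b < n"
    using Pm that by (simp add: P_def b_def e_def)
  have arr: "linear_on (vspace M i) (vspace M (Suc i)) (arr M i)" if "i \<in> {1..<n}" for i
    using rep_linear[OF rep] that by simp
  have sub: "seqspace.subspace (vspace M i)" if "i \<in> {1..n}" for i
    using rep_subspace[OF rep] that by simp
  define U where "U i = (if a \<le> i \<and> i \<le> b then range (\<lambda>t. vscale t (e i)) else {0})" for i
  obtain j where j: "e b j \<noteq> 0" using e_0[of b] b by (auto simp: fun_eq_iff)
  define \<phi> where "\<phi> i v = push M i v (b - i) j" for i v
  have \<phi>_add: "\<phi> i (v + w) = \<phi> i v + \<phi> i w" and \<phi>_scale: "\<phi> i (vscale c v) = c * \<phi> i v"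
    if "a \<le> i" "i \<le> b" "v \<in> vspace M i" "w \<in> vspace M i" for i v w c
  proof -
    have "linear_on (vspace M i) (vspace M (i + (b - i))) (\<lambda>x. push M i x (b - i))"
      by (rule push_linear[OF rep]) (use that a b in auto)
    from linear_on_add[OF this that(3,4)] linear_on_scale[OF this that(3), of c]
    show "\<phi> i (v + w) = \<phi> i v + \<phi> i w" "\<phi> i (vscale c v) = c * \<phi> i v"
      by (simp_all add: \<phi>_def vscale_def)
  qed
  have \<phi>_arr: "\<phi> (Suc i) (arr M i v) = \<phi> i v" if "i < b" for i v
    using that by (simp add: \<phi>_def push_arr Suc_diff_Suc del: push.simps)
  have \<phi>_e: "\<phi> i (e i) = e b j" if "a \<le> i" "i \<le> b" for i
    using push_push[of M a "i - a" x "b - i"] that by (simp add: \<phi>_def e_def)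
  define W where "W i = (if a \<le> i \<and> i \<le> b then {v\<in>vspace M i. \<phi> i v = 0} else vspace M i)" for i
  have zero: "0 \<in> vspace M i" if "i \<in> {1..n}" for i using rep_0[OF rep] that by simp
  have scale_e: "vscale t (e i) \<in> vspace M i" if "a \<le> i" "i \<le> b" for t i
    using sub[of i] e_in[OF that] that a b by (simp add: seqspace.subspace_scale)
  have \<phi>_0: "\<phi> i 0 = 0" if "a \<le> i" "i \<le> b" for i
    using \<phi>_scale[OF that zero zero, of 0] that a b by simp
  have "subrep n M U"
    unfolding subrep_def
  proof (intro conjI ballI subsetI)
    fix i assume i: "i \<in> {1..n}"
    have "seqspace.subspace (range (\<lambda>t. vscale t (e i)))" using fd_space_line fd_space_subspace by blast
    then show "seqspace.subspace (U i)" by (simp add: U_def)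
    show "v \<in> vspace M i" if "v \<in> U i" for v
      using that zero[OF i] scale_e[of i] by (auto simp: U_def split: if_splits)
  next
    fix i v assume i: "i \<in> {1..<n}" and "v \<in> arr M i ` U i"
    then obtain u where u: "v = arr M i u" "u \<in> U i" by blast
    have z: "arr M i 0 = 0" using linear_on_0[OF arr[OF i]] zero i by simp
    have U0: "0 \<in> U k" for k using rangeI[of "\<lambda>t. vscale t (e k)" 0] by (simp add: U_def)
    show "v \<in> U (i + 1)"
    proof (cases "a \<le> i \<and> i \<le> b")
      case True
      then obtain t where "u = vscale t (e i)" using u by (auto simp: U_def)
      then have v: "v = vscale t (arr M i (e i))"
        using linear_on_scale[OF arr[OF i]] e_in True u by simp
      show ?thesis
      proof (cases "i = b")
        case True
        then show ?thesis using v arr_b i U0 by simp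
      next
        case False
        then have "U (i + 1) = range (\<lambda>t. vscale t (e (Suc i)))" using True by (simp add: U_def)
        moreover have "v = vscale t (e (Suc i))" using v arr_e[of i] True by simp
        ultimately show ?thesis using rangeI[of "\<lambda>t. vscale t (e (Suc i))" t] by (simp only:)
      qed
    next
      case False
      then have "u = 0" using u(2) by (simp only: U_def if_False singleton_iff)
      then show ?thesis using u(1) z U0[of "i + 1"] by simp
    qed
  qed
  moreover have "subrep n M W"
    unfolding subrep_def
  proof (intro conjI ballI subsetI)
    fix i assume i: "i \<in> {1..n}"
    show "seqspace.subspace (W i)"
    proof (cases "a \<le> i \<and> i \<le> b")
      case True
      then show ?thesis
        using \<phi>_add[of i] \<phi>_scale[of i] \<phi>_0[of i] sub[OF i]
        by (auto simp: W_def seqspace.subspace_def)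
    qed (use sub[OF i] in \<open>auto simp: W_def\<close>)
    show "v \<in> vspace M i" if "v \<in> W i" for v using that by (auto simp: W_def split: if_splits)
  next
    fix i v assume i: "i \<in> {1..<n}" and "v \<in> arr M i ` W i"
    then obtain u where u: "v = arr M i u" "u \<in> W i" by blast
    then have "u \<in> vspace M i" by (auto simp: W_def split: if_splits)
    then have v: "v \<in> vspace M (Suc i)" using linear_on_in[OF arr[OF i]] u by simp
    \<comment> \<open>Inside \<open>[a, b]\<close> the functional is preserved by the arrow; on
      entering \<open>a\<close> the source is zero by minimality of \<open>a\<close>; in all other
      cases the target is the full space.\<close>
    consider "a \<le> i" "i < b" | "Suc i = a" | "Suc i < a \<or> b < Suc i" by linarith
    then show "v \<in> W (i + 1)"
    proof cases
      case 1
      then show ?thesis using v u \<phi>_arr[of i u] by (auto simp: W_def)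
    next
      case 2
      then have "u = 0" using below[of i] i \<open>u \<in> vspace M i\<close> by auto
      then have "v = 0" using u linear_on_0[OF arr[OF i]] zero i by simp
      then show ?thesis using v \<phi>_0[of a] 2 b by (simp add: W_def)
    next
      case 3
      then show ?thesis using v by (auto simp: W_def)
    qed
  qed
  moreover have "U i \<inter> W i = {0} \<and> vspace M i = {u + w |u w. u \<in> U i \<and> w \<in> W i}" if i: "i \<in> {1..n}" for i
  proof (cases "a \<le> i \<and> i \<le> b")
    case True
    have \<phi>t: "\<phi> i (vscale t (e i)) = t * e b j" for t
      using \<phi>_scale[of i "e i" "e i" t] \<phi>_e[of i] e_in[of i] True by simp
    have "v = 0" if "v \<in> U i" "v \<in> W i" for v
      using that True \<phi>t j by (auto simp: U_def W_def)
    moreover have "0 \<in> U i" "0 \<in> W i"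
      using True \<phi>_0[of i] zero[OF i] rangeI[of "\<lambda>t. vscale t (e i)" 0] by (auto simp: U_def W_def)
    moreover have "\<exists>u w. v = u + w \<and> u \<in> U i \<and> w \<in> W i" if v: "v \<in> vspace M i" for v
    proof -
      \<comment> \<open>The coefficient of the projection onto \<open>U\<close>, chosen so that
        \<open>\<phi> i\<close> vanishes on the remainder.\<close>
      define t where "t = \<phi> i v / e b j"
      let ?w = "v + vscale (- t) (e i)"
      have "v = vscale t (e i) + ?w" by (simp add: vscale_def fun_eq_iff)
      moreover have "vscale t (e i) \<in> U i"
        using True rangeI[of "\<lambda>t. vscale t (e i)" t] by (simp only: U_def if_True simp_thms)
      moreover have "?w \<in> vspace M i"
        by (rule seqspace.subspace_add[OF sub[OF i] v scale_e]) (use True in auto)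
      moreover have "\<phi> i ?w = \<phi> i v + \<phi> i (vscale (- t) (e i))"
        by (rule \<phi>_add[OF _ _ v scale_e]) (use True in auto)
      then have "\<phi> i ?w = 0"
        unfolding \<phi>t using j by (simp add: t_def)
      ultimately show ?thesis using True unfolding W_def by (metis (mono_tags, lifting) mem_Collect_eq)
    qed
    moreover have "u + w \<in> vspace M i" if "u \<in> U i" "w \<in> W i" for u w
      using that True scale_e[of i] seqspace.subspace_add[OF sub[OF i]] by (auto simp: U_def W_def)
    ultimately show ?thesis by blast
  next
    case False
    then show ?thesis using zero[OF i] by (auto simp: U_def W_def)
  qed
  ultimately have d: "direct_sum_decomposition n M U W"
    unfolding direct_sum_decomposition_def by simp
  have "U a \<noteq> {0}"
    using e_0[of a] b rangeI[of "\<lambda>t. vscale t (e a)" 1] by (auto simp: U_def)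
  moreover have "(\<forall>i\<in>{1..n}. U i = {0}) \<or> (\<forall>i\<in>{1..n}. W i = {0})"
    using indec d by (simp only: indecomposable_def)
  ultimately have W0: "W i = {0}" if "i \<in> {1..n}" for i
    using a(1) that by metis
  have UM: "vspace M i = U i" if "i \<in> {1..n}" for i
  proof -
    have "vspace M i = {u + w |u w. u \<in> U i \<and> w \<in> W i}"
      using d that by (simp only: direct_sum_decomposition_def)
    then show ?thesis by (simp add: W0[OF that])
  qed
  have "interval_rep n M a b e"
    using rep a b e_0 arr_e UM by unfold_locales (auto simp: U_def)
  then show ?thesis by blast
qed

definition interval_module :: "nat \<Rightarrow> nat \<Rightarrow> 'k::field rep" where
  "interval_module a b =
     \<lparr>vspace = (\<lambda>i. if a \<le> i \<and> i \<le> b then range (\<lambda>t. vscale t (unit_vec 0)) else {0}),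
      arr = (\<lambda>i v. if a \<le> i \<and> i < b then v else 0)\<rparr>"

lemma interval_rep_interval_module:
  assumes "1 \<le> a" "a \<le> b" "b \<le> n"
  shows "interval_rep n (interval_module a b) a b (\<lambda>_. unit_vec 0 :: nat \<Rightarrow> 'k::field)"
proof
  have "0 \<in> range (\<lambda>t. vscale t (unit_vec 0 :: nat \<Rightarrow> 'k))" by (metis rangeI seqspace.scale_zero_left)
  then show "representation n (interval_module a b :: 'k rep)"
    unfolding representation_def interval_module_def linear_on_def
    by (auto simp: fd_space_0 fd_space_line)
qed (use assms unit_vec_nonzero in \<open>auto simp: interval_module_def\<close>)

section \<open>Homomorphisms and extensions between two interval modules\<close>

locale two_interval_reps = M: interval_rep n M a b e + N: interval_rep n N c d e'
  for n and M N :: "'k::field rep" and a b c d e e'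
begin

lemma isomorphic_if_eq:
  assumes "a = c" "b = d"
  shows "isomorphic n M N"
proof -
  define f where "f i x = (if a \<le> i \<and> i \<le> b then vscale (M.coef i x) (e' i) else 0)" for i x
  have "morphism n M N f"
    unfolding morphism_def
  proof (intro conjI ballI)
    fix i assume i: "i \<in> {1..n}"
    have sub: "seqspace.subspace (vspace N i)" using rep_subspace[OF N.rep] i by simp
    show "linear_on (vspace M i) (vspace N i) (f i)"
    proof (cases "a \<le> i \<and> i \<le> b")
      case True
      then have "f i = (\<lambda>x. vscale (M.coef i x) (e' i))" by (simp add: f_def fun_eq_iff)
      then show ?thesis using M.coef_linear[OF sub] N.e_in True i assms by simp
    qed (use N.zero_in i in \<open>auto simp: linear_on_def f_def\<close>)
  next
    fix i x assume i: "i \<in> {1..<n}" and x: "x \<in> vspace M i"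
    have z: "arr N i 0 = 0" "arr M i 0 = 0" using N.arr_0 M.arr_0 i by auto
    consider "a \<le> i" "i < b" | "a \<le> i" "i = b" | "i < a \<or> b < i" by linarith
    then show "f (i + 1) (arr M i x) = arr N i (f i x)"
    proof cases
      case 1
      then obtain t where "x = vscale t (e i)" using M.inside_cases x by (metis less_imp_le)
      then show ?thesis using 1 M.arr_scale_e N.arr_scale_e assms by (simp add: f_def)
    next
      case 2
      then show ?thesis
        using N.arr_end N.scale_e_in[of b] assms i M.bounds by (simp add: f_def)
    next
      case 3
      then have "x = 0" using M.vspace_outside[of i] i x by auto
      then show ?thesis using 3 z M.bounds by (simp add: f_def)
    qed
  qed
  moreover have "bij_betw (f i) (vspace M i) (vspace N i)" if i: "i \<in> {1..n}" for i
  proof (cases "a \<le> i \<and> i \<le> b")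
    case True
    have "inj_on (f i) (vspace M i)"
      using True N.e_nonzero[of i] assms M.vspace_inside[of i] by (auto simp: inj_on_def f_def)
    moreover have "f i ` vspace M i = vspace N i"
      using True assms M.vspace_inside[of i] N.vspace_inside[of i] by (auto simp: f_def image_image)
    ultimately show ?thesis by (simp add: bij_betw_def)
  next
    case False
    then show ?thesis
      using M.vspace_outside[of i] N.vspace_outside[of i] i assms by (auto simp: f_def bij_betw_def)
  qed
  ultimately show ?thesis unfolding isomorphic_def by blast
qed

text \<open>A nonzero map has image \<open>M_ad\<close>: quotients of \<open>M\<close> keep its left
  end, submodules of \<open>N\<close> its right end. A map is determined by the image of the
  generator \<open>e a\<close>. If \<open>N\<close> lives at \<open>a\<close> but reaches beyond
  \<open>b\<close>, that image must die at \<open>b + 1\<close>, although the path from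
  \<open>a\<close> to \<open>b + 1\<close> is injective on \<open>N\<close>.\<close>

lemma Hom_zero_iff: "Hom_zero n M N \<longleftrightarrow> \<not> (c \<le> a \<and> a \<le> d \<and> d \<le> b)"
proof
  assume hom: "Hom_zero n M N"
  show "\<not> (c \<le> a \<and> a \<le> d \<and> d \<le> b)"
  proof
    assume cd: "c \<le> a \<and> a \<le> d \<and> d \<le> b"
    define f where "f i x = (if a \<le> i \<and> i \<le> d then vscale (M.coef i x) (e' i) else 0)" for i x
    have "morphism n M N f"
      unfolding morphism_def
    proof (intro conjI ballI)
      fix i assume i: "i \<in> {1..n}"
      have sub: "seqspace.subspace (vspace N i)" using rep_subspace[OF N.rep] i by simp
      show "linear_on (vspace M i) (vspace N i) (f i)"
      proof (cases "a \<le> i \<and> i \<le> d")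
        case True
        then have "f i = (\<lambda>x. vscale (M.coef i x) (e' i))" by (simp add: f_def fun_eq_iff)
        then show ?thesis using M.coef_linear[OF sub] N.e_in True i cd by simp
      qed (use N.zero_in i in \<open>auto simp: linear_on_def f_def\<close>)
    next
      fix i x assume i: "i \<in> {1..<n}" and x: "x \<in> vspace M i"
      have z: "arr N i 0 = 0" "arr M i 0 = 0" using N.arr_0 M.arr_0 i by auto
      consider "a \<le> i" "i < d" | "a \<le> i" "i = d" | "i < a" | "d < i" by linarith
      then show "f (i + 1) (arr M i x) = arr N i (f i x)"
      proof cases
        case 1
        then obtain t where "x = vscale t (e i)" using M.inside_cases[OF x] cd by force
        then show ?thesis using 1 M.arr_scale_e[of i] N.arr_scale_e[of i] cd by (simp add: f_def)
      next
        case 2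
        then show ?thesis
          using N.arr_end N.scale_e_in[of d] i N.bounds by (simp add: f_def)
      next
        case 3
        then have "x = 0" using M.vspace_outside[of i] i x by auto
        then show ?thesis using 3 z M.bounds cd by (simp add: f_def)
      next
        case 4
        then show ?thesis using z by (simp add: f_def)
      qed
    qed
    then have "f a (e a) = 0" using hom M.e_in[of a] M.bounds unfolding Hom_zero_def by auto
    moreover have "f a (e a) = e' a" using cd by (simp add: f_def)
    ultimately show False using N.e_nonzero[of a] cd by simp
  qed
next
  assume ncd: "\<not> (c \<le> a \<and> a \<le> d \<and> d \<le> b)"
  show "Hom_zero n M N"
    unfolding Hom_zero_def
  proof (intro allI impI ballI)
    fix f i x assume f: "morphism n M N f" and i: "i \<in> {1..n}" and x: "x \<in> vspace M i"
    have lin: "linear_on (vspace M k) (vspace N k) (f k)" if "k \<in> {1..n}" for k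
      using morphism_linear[OF f] that by simp
    have fe: "f (a + k) (e (a + k)) = push N a (f a (e a)) k" if "a + k \<le> b" for k
      using push_morphism[OF M.rep f, of a k "e a"] M.push_e[of a k 1] M.e_in[of a] that M.bounds by simp
    have "f a (e a) = 0"
    proof (cases "c \<le> a \<and> a \<le> d")
      case False
      then show ?thesis
        using N.vspace_outside[of a] linear_on_in[OF lin M.e_in, of a] M.bounds by auto
    next
      case True
      then have bd: "b < d" using ncd by auto
      obtain t where t: "f a (e a) = vscale t (e' a)"
        using N.inside_cases[OF linear_on_in[OF lin M.e_in]] True M.bounds by auto
      have "f b (e b) = vscale t (e' b)"
        using fe[of "b - a"] t N.push_e[of a "b - a" t] True bd M.bounds by simp
      then have "arr N b (f b (e b)) = vscale t (e' (Suc b))"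
        using N.arr_scale_e[of b] True bd M.bounds by simp
      moreover have "arr N b (f b (e b)) = f (Suc b) 0"
        using morphism_commute[OF f, of b "e b"] M.e_in[of b] M.arr_end[of "e b"] M.bounds N.bounds bd by simp
      moreover have "f (Suc b) 0 = 0" using linear_on_0[OF lin] M.zero_in bd N.bounds by simp
      ultimately have "t = 0" using N.e_nonzero[of "Suc b"] bd True M.bounds by simp
      then show ?thesis using t by simp
    qed
    then have zero: "f k (e k) = 0" if "a \<le> k" "k \<le> b" for k
      using fe[of "k - a"] linear_on_0[OF push_linear[OF N.rep, of a "k - a"]] N.zero_in[of a] that M.bounds
      by simp
    show "f i x = 0"
    proof (cases "a \<le> i \<and> i \<le> b")
      case True
      then obtain t where "x = vscale t (e i)" using M.inside_cases[OF x] by blast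
      then show ?thesis using linear_on_scale[OF lin[OF i] M.e_in] zero True by simp
    next
      case False
      then have "x = 0" using M.vspace_outside[of i] i x by auto
      then show ?thesis using linear_on_0[OF lin[OF i]] M.zero_in i by simp
    qed
  qed
qed

text \<open>\<open>M\<close> is generated by \<open>e a\<close> with one relation, that the path
  from \<open>a\<close> to \<open>b + 1\<close> kills it (none if \<open>b = n\<close>). So a
  splitting is a lift of \<open>e a\<close> obeying this relation. Any lift has its value at
  \<open>b + 1\<close> in \<open>N\<close>; if \<open>N\<close> lives there, the hypothesis forces
  \<open>c \<le> a\<close>, and the value comes from an element of \<open>N\<close> at
  \<open>a\<close>, which can be subtracted.\<close>

lemma Ext_zeroI:
  assumes ncd: "\<not> (a < c \<and> c \<le> b + 1 \<and> b + 1 \<le> d)"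
  shows "Ext_zero n M N"
  unfolding Ext_zero_def
proof (intro allI impI, elim conjE)
  fix X f g assume X: "representation n X" and ses: "short_exact n N f X g M"
  have f: "morphism n N X f" and g: "morphism n X M g"
    and exact: "\<And>i. i \<in> {1..n} \<Longrightarrow> f i ` vspace N i = {x\<in>vspace X i. g i x = 0}"
    and surj: "\<And>i. i \<in> {1..n} \<Longrightarrow> g i ` vspace X i = vspace M i"
    using ses by (simp_all add: short_exact_def)
  have lin_f: "linear_on (vspace N i) (vspace X i) (f i)" and lin_g: "linear_on (vspace X i) (vspace M i) (g i)"
    and sub: "seqspace.subspace (vspace X i)" if "i \<in> {1..n}" for i
    using morphism_linear[OF f] morphism_linear[OF g] rep_subspace[OF X] that by simp_all
  have a: "a \<in> {1..n}" using M.bounds by simp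
  have "e a \<in> g a ` vspace X a" using M.e_in[of a] surj[OF a] M.bounds by simp
  then obtain x where x: "x \<in> vspace X a" "g a x = e a" by auto
  have push_g: "g (a + k) (push X a y k) = push M a (g a y) k" if "a + k \<le> n" "y \<in> vspace X a" for k y
    using push_morphism[OF X g, of a k y] that M.bounds by simp
  have push_lin: "linear_on (vspace X a) (vspace X (a + k)) (\<lambda>x. push X a x k)" if "a + k \<le> n" for k
    using push_linear[OF X, of a k] that M.bounds by simp
  txt \<open>The lift of the generator of \<open>M\<close> is corrected by an element of \<open>N\<close> so that it dies after \<open>b\<close>.\<close>
  have "\<exists>y\<in>vspace X a. g a y = e a \<and> (b < n \<longrightarrow> push X a y (Suc (b - a)) = 0)"
  proof (cases "b < n")
    case True
    let ?k = "Suc (b - a)"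
    have k: "a + ?k = Suc b" "a + ?k \<le> n" using True M.bounds by auto
    let ?z = "push X a x ?k"
    have "push M a (e a) ?k = arr M b (e b)"
      using M.push_e[of a "b - a" 1] M.bounds by simp
    also have "\<dots> = 0" using M.arr_end True M.e_in M.bounds by simp
    finally have "g (Suc b) ?z = 0" using push_g[OF k(2) x(1)] x(2) k by simp
    moreover have "?z \<in> vspace X (Suc b)" using linear_on_in[OF push_lin[OF k(2)] x(1)] k by simp
    ultimately have "?z \<in> f (Suc b) ` vspace N (Suc b)" using exact[of "Suc b"] True by simp
    then obtain u where u: "u \<in> vspace N (Suc b)" "?z = f (Suc b) u" by auto
    show ?thesis
    proof (cases "c \<le> Suc b \<and> Suc b \<le> d")
      case False
      then have "u = 0" using N.vspace_outside[of "Suc b"] u True by auto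
      then have "?z = 0" using u linear_on_0[OF lin_f] N.zero_in True by simp
      then show ?thesis using x by blast
    next
      case cd: True
      then have ca: "c \<le> a" using ncd by auto
      obtain t where t: "u = vscale t (e' (Suc b))" using N.inside_cases u cd by blast
      define w where "w = f a (vscale (- t) (e' a))"
      have eN: "vscale (- t) (e' a) \<in> vspace N a"
        by (rule N.scale_e_in) (use ca cd M.bounds in auto)
      have w: "w \<in> vspace X a" using linear_on_in[OF lin_f[OF a] eN] by (simp add: w_def)
      have "g a w = 0" using exact[OF a] eN by (auto simp: w_def)
      then have "g a (x + w) = e a" using linear_on_add[OF lin_g[OF a] x(1) w] x by simp
      moreover have "push X a w ?k = f (Suc b) (vscale (- t) (e' (Suc b)))"
        using push_morphism[OF N.rep f, of a ?k "vscale (- t) (e' a)"] eN k M.bounds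
          N.push_e[of a ?k "- t"] ca cd by (simp add: w_def del: push.simps)
      then have "push X a w ?k = vscale (- 1) ?z"
        using u t linear_on_scale[OF lin_f, of "Suc b" "u" "- 1"] True by simp
      then have "push X a (x + w) ?k = ?z + vscale (- 1) ?z"
        using linear_on_add[OF push_lin[OF k(2)] x(1) w] by (simp del: push.simps)
      then have "push X a (x + w) ?k = 0" by (simp add: vscale_def fun_eq_iff del: push.simps)
      ultimately show ?thesis using seqspace.subspace_add[OF sub[OF a] x(1) w] by blast
    qed
  qed (use x in auto)
  then obtain y where y: "y \<in> vspace X a" "g a y = e a"
    and y_end: "b < n \<Longrightarrow> push X a y (Suc (b - a)) = 0" by blast
  define y' where "y' i = push X a y (i - a)" for i
  have y'_in: "y' i \<in> vspace X i" if "a \<le> i" "i \<le> b" for i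
    using linear_on_in[OF push_lin[of "i - a"] y(1)] that M.bounds by (simp add: y'_def)
  have y'_arr: "arr X i (y' i) = y' (Suc i)" if "a \<le> i" for i
    using that by (simp add: y'_def Suc_diff_le)
  have y'_g: "g i (y' i) = e i" if "a \<le> i" "i \<le> b" for i
    using push_g[of "i - a" y] y that M.push_e[of a "i - a" 1] M.bounds by (simp add: y'_def)
  \<comment> \<open>The section sends \<open>e i\<close> to the transported lift
    \<open>y' i\<close>; it commutes with the arrow out of \<open>b\<close> because the corrected
    lift dies there.\<close>
  define s where "s i x = (if a \<le> i \<and> i \<le> b then vscale (M.coef i x) (y' i) else 0)" for i x
  have arr_X: "linear_on (vspace X i) (vspace X (Suc i)) (arr X i)" if "i \<in> {1..<n}" for i
    using rep_linear[OF X] that by simp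
  have zero_X: "0 \<in> vspace X i" if "i \<in> {1..n}" for i using rep_0[OF X] that by simp
  have "morphism n M X s"
    unfolding morphism_def
  proof (intro conjI ballI)
    fix i assume i: "i \<in> {1..n}"
    show "linear_on (vspace M i) (vspace X i) (s i)"
    proof (cases "a \<le> i \<and> i \<le> b")
      case True
      then have "s i = (\<lambda>x. vscale (M.coef i x) (y' i))" by (simp add: s_def fun_eq_iff)
      then show ?thesis using M.coef_linear[OF sub[OF i]] y'_in True i by simp
    qed (use zero_X i in \<open>auto simp: linear_on_def s_def\<close>)
  next
    fix i x assume i: "i \<in> {1..<n}" and x: "x \<in> vspace M i"
    have z: "arr X i 0 = 0" "arr M i 0 = 0"
      using linear_on_0[OF arr_X[OF i]] zero_X M.arr_0 i by auto
    consider "a \<le> i" "i \<le> b" | "i < a \<or> b < i" by linarith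
    then show "s (i + 1) (arr M i x) = arr X i (s i x)"
    proof cases
      case 1
      then obtain t where t: "x = vscale t (e i)" using M.inside_cases[OF x] by blast
      have arr: "arr X i (s i x) = vscale t (y' (Suc i))"
        using 1 t y'_arr[of i] linear_on_scale[OF arr_X[OF i] y'_in] by (simp add: s_def)
      show ?thesis
      proof (cases "i = b")
        case True
        then have "y' (Suc i) = 0" using y_end i 1 by (simp add: y'_def Suc_diff_le)
        then show ?thesis using arr True by (simp add: s_def)
      next
        case False
        then show ?thesis using 1 arr t M.arr_scale_e[of i] by (simp add: s_def)
      qed
    next
      case 2
      then have "x = 0" using M.vspace_outside[of i] i x by auto
      then show ?thesis using 2 z M.bounds by (simp add: s_def)
    qed
  qed
  moreover have "g i (s i x) = x" if i: "i \<in> {1..n}" and x: "x \<in> vspace M i" for i x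
  proof (cases "a \<le> i \<and> i \<le> b")
    case True
    then obtain t where t: "x = vscale t (e i)" using M.inside_cases[OF x] by blast
    then show ?thesis
      using True linear_on_scale[OF lin_g[OF i] y'_in] y'_g by (simp add: s_def)
  next
    case False
    then have "x = 0" using M.vspace_outside[of i] i x by auto
    then show ?thesis using False linear_on_0[OF lin_g[OF i] zero_X[OF i]] by (simp add: s_def)
  qed
  ultimately show "\<exists>s. morphism n M X s \<and> (\<forall>i\<in>{1..n}. \<forall>x\<in>vspace M i. g i (s i x) = x)" by blast
qed

text \<open>The non-split extension of \<open>M\<close> by \<open>N\<close>: \<open>M\<close> lives in coordinate 0, \<open>N\<close> in coordinate 1, and the
  arrow out of \<open>b\<close> sends the generator of \<open>M\<close> at \<open>b\<close> to that of \<open>N\<close> at \<open>b + 1\<close>.\<close>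

definition glue :: "'k rep" where
  "glue =
     \<lparr>vspace = (\<lambda>i. {v. \<forall>k. k \<notin> {k. k = 0 \<and> a \<le> i \<and> i \<le> b \<or> k = 1 \<and> c \<le> i \<and> i \<le> d} \<longrightarrow> v k = 0}),
      arr = (\<lambda>i v k. if k = 0 then if a \<le> i \<and> i < b then v 0 else 0
        else if k = 1 then (if c \<le> i \<and> i < d then v 1 else 0) + (if i = b then v 0 else 0)
        else 0)\<rparr>"

text \<open>A section would send \<open>e b\<close> to a vector with coordinate 0 equal to 1 and
  coordinate 1 equal to 0. The arrow out of \<open>b\<close> turns this into a vector with
  coordinate 1 equal to 1, whereas \<open>e b\<close> itself dies in \<open>M\<close>.\<close>

lemma Ext_nonzero:
  assumes acbd: "a < c" "c \<le> b + 1" "b + 1 \<le> d"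
  shows "\<not> Ext_zero n M N"
proof
  assume ext: "Ext_zero n M N"
  have vspace_glue: "v \<in> vspace glue i \<longleftrightarrow>
      (\<not> (a \<le> i \<and> i \<le> b) \<longrightarrow> v 0 = 0) \<and> (\<not> (c \<le> i \<and> i \<le> d) \<longrightarrow> v 1 = 0) \<and> (\<forall>k\<ge>2. v k = 0)" for v i
  proof -
    from all_nat_split_0_1[of "\<lambda>k. k \<notin> {k. k = 0 \<and> a \<le> i \<and> i \<le> b \<or> k = 1 \<and> c \<le> i \<and> i \<le> d} \<longrightarrow> v k = 0"]
    show ?thesis unfolding glue_def by simp
  qed
  have fd: "fd_space (vspace glue i)" for i
  proof -
    have "finite {k::nat. k = 0 \<and> a \<le> i \<and> i \<le> b \<or> k = 1 \<and> c \<le> i \<and> i \<le> d}"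
      by (rule finite_subset[of _ "{0, 1}"]) auto
    then show ?thesis
      unfolding fd_space_def glue_def rep.select_convs using span_unit_vecs[symmetric] finite_imageI by blast
  qed
  have arr_glue: "arr glue i v = (\<lambda>k. if k = 0 then if a \<le> i \<and> i < b then v 0 else 0
        else if k = 1 then (if c \<le> i \<and> i < d then v 1 else 0) + (if i = b then v 0 else 0)
        else 0)" for i v
    by (simp add: glue_def)
  have lin: "linear_on (vspace glue i) (vspace glue (i + 1)) (arr glue i)" for i
  proof (rule linear_onI)
    show "arr glue i v \<in> vspace glue (i + 1)" if "v \<in> vspace glue i" for v
      unfolding vspace_glue arr_glue using acbd by simp
  qed (auto simp: arr_glue vscale_def algebra_simps)
  have rep: "representation n glue" using fd lin by (simp add: representation_def)
  define f where "f i x = (\<lambda>k::nat. if k = 1 \<and> c \<le> i \<and> i \<le> d then N.coef i x else 0)" for i x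
  define g where "g i v = (if a \<le> i \<and> i \<le> b then vscale (v 0) (e i) else 0)" for i and v :: "nat \<Rightarrow> 'k"
  have f_eq: "f i x = vscale (N.coef i x) (unit_vec 1)" if "c \<le> i" "i \<le> d" for i x
    using that by (auto simp: f_def vscale_def unit_vec_def fun_eq_iff)
  have f_0: "f i x = 0" if "\<not> (c \<le> i \<and> i \<le> d)" for i x
    using that by (auto simp: f_def fun_eq_iff)
  have f: "morphism n N glue f"
    unfolding morphism_def
  proof (intro conjI ballI)
    fix i assume i: "i \<in> {1..n}"
    show "linear_on (vspace N i) (vspace glue i) (f i)"
    proof (cases "c \<le> i \<and> i \<le> d")
      case True
      then have "f i = (\<lambda>x. vscale (N.coef i x) (unit_vec 1))" by (simp add: f_eq fun_eq_iff)
      moreover have "unit_vec 1 \<in> vspace glue i" using True by (simp add: vspace_glue unit_vec_def)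
      ultimately show ?thesis
        using N.coef_linear[OF fd_space_subspace[OF fd]] True i by simp
    next
      case False
      then show ?thesis using rep_0[OF rep] i by (auto simp: linear_on_def f_0)
    qed
  next
    fix i x assume i: "i \<in> {1..<n}" and x: "x \<in> vspace N i"
    consider "c \<le> i" "i < d" | "c \<le> i" "i = d" | "i < c \<or> d < i" by linarith
    then show "f (i + 1) (arr N i x) = arr glue i (f i x)"
    proof cases
      case 1
      then obtain t where "x = vscale t (e' i)" using N.inside_cases[OF x] by force
      then have "N.coef (Suc i) (arr N i x) = N.coef i x" using 1 N.arr_scale_e[of i] by simp
      then show ?thesis using 1 by (auto simp: f_def arr_glue)
    next
      case 2
      then show ?thesis by (auto simp: f_def arr_glue fun_eq_iff)
    next
      case 3
      then have "x = 0" using N.vspace_outside[of i] i x by auto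
      then have "arr N i x = 0" using N.arr_0 i by simp
      moreover have "f (i + 1) 0 = 0"
        using f_eq[of "i + 1" 0] f_0[of "i + 1" 0] by (cases "c \<le> i + 1 \<and> i + 1 \<le> d") auto
      moreover have "f i x = 0" by (rule f_0) (use 3 in auto)
      moreover have "arr glue i 0 = 0" by (simp add: arr_glue fun_eq_iff)
      ultimately show ?thesis by simp
    qed
  qed
  have g: "morphism n glue M g"
    unfolding morphism_def
  proof (intro conjI ballI)
    fix i assume i: "i \<in> {1..n}"
    show "linear_on (vspace glue i) (vspace M i) (g i)"
      using M.scale_e_in[of i] M.zero_in[of i] i
      by (intro linear_onI) (auto simp: g_def vscale_def fun_eq_iff algebra_simps)
  next
    fix i v assume i: "i \<in> {1..<n}" and v: "v \<in> vspace glue i"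
    have z: "arr M i 0 = 0" using M.arr_0 i by simp
    consider "a \<le> i" "i < b" | "a \<le> i" "i = b" | "i < a \<or> b < i" by linarith
    then show "g (i + 1) (arr glue i v) = arr M i (g i v)"
    proof cases
      case 1
      then show ?thesis using M.arr_scale_e[of i] by (simp add: g_def arr_glue)
    next
      case 2
      then show ?thesis using M.arr_end M.scale_e_in[of b] i M.bounds by (simp add: g_def)
    next
      case 3
      then show ?thesis using z by (auto simp: g_def arr_glue)
    qed
  qed
  have "short_exact n N f glue g M"
    unfolding short_exact_def
  proof (intro conjI ballI f g)
    fix i assume i: "i \<in> {1..n}"
    have ker: "v \<in> vspace glue i \<and> g i v = 0 \<longleftrightarrow> (\<not> (c \<le> i \<and> i \<le> d) \<longrightarrow> v 1 = 0) \<and> (\<forall>k. k \<noteq> 1 \<longrightarrow> v k = 0)" for v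
    proof -
      have "(\<forall>k. k \<noteq> 1 \<longrightarrow> v k = 0) \<longleftrightarrow> v 0 = 0 \<and> (\<forall>k\<ge>2. v k = 0)"
        using all_nat_split_0_1[of "\<lambda>k. k \<noteq> 1 \<longrightarrow> v k = 0"] by auto
      moreover have "g i v = 0 \<longleftrightarrow> (a \<le> i \<and> i \<le> b \<longrightarrow> v 0 = 0)"
        using M.e_nonzero[of i] by (auto simp: g_def)
      ultimately show ?thesis unfolding vspace_glue by blast
    qed
    show "inj_on (f i) (vspace N i)"
    proof (cases "c \<le> i \<and> i \<le> d")
      case True
      then show ?thesis
        unfolding inj_on_def N.vspace_inside[OF conjunct1[OF True] conjunct2[OF True]]
        using unit_vec_nonzero[of 1, where 'a='k] by (auto simp: f_eq)
    next
      case False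
      then show ?thesis using N.vspace_outside[of i] i by auto
    qed
    show "f i ` vspace N i = {x\<in>vspace glue i. g i x = 0}"
    proof (cases "c \<le> i \<and> i \<le> d")
      case True
      have "f i ` vspace N i = range (\<lambda>t. vscale t (unit_vec 1))"
        unfolding N.vspace_inside[OF conjunct1[OF True] conjunct2[OF True]]
        using True by (simp add: f_eq image_image)
      moreover have "v \<in> range (\<lambda>t. vscale t (unit_vec 1)) \<longleftrightarrow> (\<forall>k. k \<noteq> 1 \<longrightarrow> v k = 0)" for v :: "nat \<Rightarrow> 'k"
      proof
        assume "\<forall>k. k \<noteq> 1 \<longrightarrow> v k = 0"
        then have "v = vscale (v 1) (unit_vec 1)" by (auto simp: vscale_def unit_vec_def fun_eq_iff)
        then show "v \<in> range (\<lambda>t. vscale t (unit_vec 1))" by (rule image_eqI) simp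
      qed (auto simp: vscale_def unit_vec_def)
      then have "range (\<lambda>t. vscale t (unit_vec 1)) = {v :: nat \<Rightarrow> 'k. \<forall>k. k \<noteq> 1 \<longrightarrow> v k = 0}"
        by (intro set_eqI) (simp only: mem_Collect_eq)
      moreover have "{v \<in> vspace glue i. g i v = 0} = {v. \<forall>k. k \<noteq> 1 \<longrightarrow> v k = 0}"
        unfolding ker using True by simp
      ultimately show ?thesis by simp
    next
      case False
      have "f i ` vspace N i = {0}" using False N.zero_in[of i] i by (auto simp: f_0)
      moreover have "v \<in> vspace glue i \<and> g i v = 0 \<longleftrightarrow> v = 0" for v
      proof -
        have "v = 0 \<longleftrightarrow> (\<forall>k. v k = 0)" by (simp add: fun_eq_iff)
        then show ?thesis unfolding ker using False by metis
      qed
      ultimately show ?thesis by auto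
    qed
    show "g i ` vspace glue i = vspace M i"
    proof (cases "a \<le> i \<and> i \<le> b")
      case True
      have "vscale t (unit_vec 0) \<in> vspace glue i" "g i (vscale t (unit_vec 0)) = vscale t (e i)" for t
        using True by (auto simp: vspace_glue g_def vscale_def unit_vec_def)
      then have "vscale t (e i) \<in> g i ` vspace glue i" for t by (metis imageI)
      moreover have "g i v \<in> vspace M i" for v using M.scale_e_in True by (simp add: g_def)
      ultimately show ?thesis using M.vspace_inside True by auto
    next
      case False
      then show ?thesis using M.vspace_outside[of i] rep_0[OF rep, of i] i by (auto simp: g_def)
    qed
  qed
  then obtain s where s: "morphism n M glue s" and gs: "\<forall>i\<in>{1..n}. \<forall>x\<in>vspace M i. g i (s i x) = x"
    using ext rep unfolding Ext_zero_def by blast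
  have s_in: "s i (e i) \<in> vspace glue i" if "a \<le> i" "i \<le> b" for i
    using linear_on_in[OF morphism_linear[OF s] M.e_in] that M.bounds by simp
  have s_0: "s i (e i) 0 = 1" if "a \<le> i" "i \<le> b" for i
  proof -
    have "g i (s i (e i)) = e i" using gs M.e_in[of i] that M.bounds by simp
    then have "vscale (s i (e i) 0) (e i) = vscale 1 (e i)" using that by (simp add: g_def)
    then show ?thesis using M.e_nonzero that unfolding vscale_cancel by blast
  qed
  \<comment> \<open>Coordinate 1 vanishes at \<open>a\<close> because \<open>a < c\<close> means
    that \<open>N\<close> is zero there, and the arrows before \<open>b\<close> do not mix the two
    coordinates.\<close>
  have s_1: "s (a + k) (e (a + k)) 1 = 0" if "a + k \<le> b" for k
    using that
  proof (induction k)
    case 0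
    then show ?case using s_in[of a] acbd M.bounds by (simp add: vspace_glue)
  next
    case (Suc k)
    have "s (Suc (a + k)) (e (Suc (a + k))) = arr glue (a + k) (s (a + k) (e (a + k)))"
      using morphism_commute[OF s, of "a + k" "e (a + k)"] M.e_in[of "a + k"] M.arr_e[of "a + k"]
        Suc.prems M.bounds by simp
    then show ?case using Suc by (simp add: arr_glue)
  qed
  have b: "b < n" using acbd N.bounds by simp
  have "s (Suc b) (arr M b (e b)) = 0"
    using M.arr_end M.e_in linear_on_0[OF morphism_linear[OF s]] M.zero_in b M.bounds by simp
  then have "arr glue b (s b (e b)) = 0"
    using morphism_commute[OF s, of b "e b"] M.e_in[of b] b M.bounds by simp
  then have "arr glue b (s b (e b)) 1 = 0" by (simp only: zero_fun_apply)
  moreover have "arr glue b (s b (e b)) 1 = 1"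
    using s_0[of b] s_1[of "b - a"] M.bounds by (simp add: arr_glue)
  ultimately show False by simp
qed

lemma Ext_zero_iff: "Ext_zero n M N \<longleftrightarrow> \<not> (a < c \<and> c \<le> b + 1 \<and> b + 1 \<le> d)"
  using Ext_zeroI Ext_nonzero by blast

end


section \<open>Forest orders and their Hasse diagrams\<close>

text \<open>What lies above an element is a chain. All conditions are relative to \<open>V\<close>,
  since the comparison of supports is uncontrolled for indices outside
  \<open>{1..n}\<close>.\<close>

definition forest_order :: "'a set \<Rightarrow> ('a \<Rightarrow> 'a \<Rightarrow> bool) \<Rightarrow> bool" where
  "forest_order V lt \<longleftrightarrow> finite V \<and> (\<forall>x\<in>V. \<not> lt x x) \<and>
     (\<forall>x\<in>V. \<forall>y\<in>V. \<forall>z\<in>V. lt x y \<longrightarrow> lt y z \<longrightarrow> lt x z) \<and>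
     (\<forall>x\<in>V. \<forall>y\<in>V. \<forall>z\<in>V. lt x y \<longrightarrow> lt x z \<longrightarrow> y = z \<or> lt y z \<or> lt z y)"

context
  fixes V :: "'a set" and lt :: "'a \<Rightarrow> 'a \<Rightarrow> bool"
  assumes forest: "forest_order V lt"
begin

lemma forest_irrefl: "x \<in> V \<Longrightarrow> \<not> lt x x"
  and forest_trans: "x \<in> V \<Longrightarrow> y \<in> V \<Longrightarrow> z \<in> V \<Longrightarrow> lt x y \<Longrightarrow> lt y z \<Longrightarrow> lt x z"
  and forest_chain: "x \<in> V \<Longrightarrow> y \<in> V \<Longrightarrow> z \<in> V \<Longrightarrow> lt x y \<Longrightarrow> lt x z \<Longrightarrow> y = z \<or> lt y z \<or> lt z y"
  and forest_finite: "finite V"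
  using forest unfolding forest_order_def by (blast, blast, blast, blast)

text \<open>The number of elements above \<open>x\<close> is its distance from its root; it is the
  usual induction measure for forest orders here.\<close>

lemma card_above_less:
  assumes "x \<in> V" "y \<in> V" "lt x y"
  shows "card {z\<in>V. lt y z} < card {z\<in>V. lt x z}"
proof (rule psubset_card_mono)
  show "{z\<in>V. lt y z} \<subset> {z\<in>V. lt x z}"
    using assms forest_trans[OF assms(1,2)] forest_irrefl by blast
qed (simp add: forest_finite)

lemma covered_by_unique:
  "covered_by V lt x y \<Longrightarrow> covered_by V lt x z \<Longrightarrow> y = z"
  using forest_chain[of x y z] unfolding covered_by_def by blast

text \<open>\<open>z\<close> is the first step of the chain from \<open>x\<close> up to
  \<open>y\<close>. The induction lowers \<open>y\<close> towards \<open>x\<close>, so its measure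
  counts the elements that are not above \<open>y\<close>.\<close>

lemma ex_cover_below:
  assumes "x \<in> V" "y \<in> V" "lt x y"
  obtains z where "covered_by V lt x z" "z = y \<or> lt z y"
proof -
  have "\<exists>z. covered_by V lt x z \<and> (z = y \<or> lt z y)"
    using assms(2,3)
  proof (induction y rule: measure_induct_rule[of "\<lambda>y. card (V - {z\<in>V. lt y z})"])
    case (less y)
    show ?case
    proof (cases "covered_by V lt x y")
      case False
      then obtain z where z: "z \<in> V" "lt x z" "lt z y"
        using less.prems assms(1) unfolding covered_by_def by blast
      have "card {u\<in>V. lt y u} < card {u\<in>V. lt z u}" using card_above_less z less.prems by blast
      moreover have "card {u\<in>V. lt z u} \<le> card V" by (rule card_mono) (auto simp: forest_finite)
      moreover have diff: "card (V - {z\<in>V. lt u z}) = card V - card {z\<in>V. lt u z}" for u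
        by (rule card_Diff_subset) (auto simp: forest_finite)
      ultimately have "card (V - {u\<in>V. lt z u}) < card (V - {u\<in>V. lt y u})"
        unfolding diff by linarith
      then obtain c where "covered_by V lt x c" "c = z \<or> lt c z" using less.IH z by blast
      moreover then have "c = y \<or> lt c y"
        using z less.prems forest_trans[of c z y] unfolding covered_by_def by blast
      ultimately show ?thesis by blast
    qed blast
  qed
  then show ?thesis using that by blast
qed

lemma ex_maximal_above:
  assumes "x \<in> V"
  shows "\<exists>m\<in>maximal_elements V lt. m = x \<or> lt x m"
  using assms
proof (induction x rule: measure_induct_rule[of "\<lambda>x. card {z\<in>V. lt x z}"])
  case (less x)
  show ?case
  proof (cases "\<exists>y\<in>V. lt x y")
    case True
    then obtain y where y: "y \<in> V" "lt x y" by blast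
    then obtain m where "m \<in> maximal_elements V lt" "m = y \<or> lt y m"
      using less.IH card_above_less less.prems by meson
    then show ?thesis using y less.prems forest_trans[of x y m] unfolding maximal_elements_def by blast
  qed (use less.prems in \<open>auto simp: maximal_elements_def\<close>)
qed

lemma hasse_edges_simple_graph: "simple_graph V (hasse_edges V lt)"
  unfolding simple_graph_def
proof
  fix e assume "e \<in> hasse_edges V lt"
  then obtain x y where "e = {x, y}" "covered_by V lt x y" by (auto simp: hasse_edges_def)
  moreover then have "x \<in> V" "y \<in> V" "x \<noteq> y" using forest_irrefl by (auto simp: covered_by_def)
  ultimately show "\<exists>x\<in>V. \<exists>y\<in>V. x \<noteq> y \<and> e = {x, y}" by blast
qed

lemma hasse_edge_cases:
  assumes "{x, y} \<in> hasse_edges V lt"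
  shows "covered_by V lt x y \<or> covered_by V lt y x"
  using assms unfolding hasse_edges_def by (auto simp: doubleton_eq_iff)

text \<open>Take a vertex of the cycle with the most elements above it. Both its neighbours must
  cover it, and covers are unique, so the neighbours coincide.\<close>

lemma hasse_edges_acyclic: "\<not> graph_cycle (hasse_edges V lt) xs"
proof
  assume cycle: "graph_cycle (hasse_edges V lt) xs"
  let ?n = "length xs"
  have len: "?n \<ge> 3" and dist: "distinct xs"
    and edge: "\<And>k. k < ?n \<Longrightarrow> {xs ! k, xs ! ((k + 1) mod ?n)} \<in> hasse_edges V lt"
    using cycle by (auto simp: graph_cycle_def)
  let ?h = "\<lambda>k. card {z\<in>V. lt (xs ! k) z}"
  have "finite (?h ` {..<?n})" "?h ` {..<?n} \<noteq> {}" using len by (auto simp: lessThan_empty_iff)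
  then have "Max (?h ` {..<?n}) \<in> ?h ` {..<?n}" by (rule Max_in)
  then obtain k where k: "k < ?n" "?h k = Max (?h ` {..<?n})" by auto
  then have max: "?h i \<le> ?h k" if "i < ?n" for i using that by simp
  define i where "i = (k + 1) mod ?n"
  \<comment> \<open>The cyclic predecessor of \<open>k\<close>, by cases to avoid subtracting from
    0. It differs from the successor \<open>i\<close> because the length is at least 3.\<close>
  define j where "j = (if k = 0 then ?n - 1 else k - 1)"
  have ij: "i < ?n" "j < ?n" "i \<noteq> j" using k len by (auto simp: i_def j_def mod_if)
  have jk: "(j + 1) mod ?n = k" using k len by (auto simp: j_def)
  have up: "covered_by V lt (xs ! k) (xs ! p)"
    if "{xs ! k, xs ! p} \<in> hasse_edges V lt" "p < ?n" for p
  proof -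
    have "\<not> covered_by V lt (xs ! p) (xs ! k)"
      using max[OF that(2)] card_above_less[of "xs ! p" "xs ! k"]
      unfolding covered_by_def by force
    then show ?thesis using hasse_edge_cases[OF that(1)] by blast
  qed
  have "covered_by V lt (xs ! k) (xs ! i)" using up edge[OF k(1)] ij by (simp add: i_def)
  moreover have "covered_by V lt (xs ! k) (xs ! j)"
    using up edge[OF ij(2)] ij jk by (simp add: insert_commute)
  ultimately have "xs ! i = xs ! j" by (rule covered_by_unique)
  then show False using dist ij by (simp add: nth_eq_iff_index_eq)
qed

lemma connected_to_maximal:
  assumes "x \<in> V" "m \<in> maximal_elements V lt" "m = x \<or> lt x m"
  shows "graph_connected (hasse_edges V lt) x m"
  using assms(1,3)
proof (induction x rule: measure_induct_rule[of "\<lambda>x. card {z\<in>V. lt x z}"])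
  case (less x)
  have m: "m \<in> V" using assms(2) by (simp add: maximal_elements_def)
  show ?case
  proof (cases "m = x")
    case False
    then have "lt x m" using less.prems by blast
    then obtain z where z: "covered_by V lt x z" "z = m \<or> lt z m" using ex_cover_below less.prems(1) m by blast
    then have zV: "z \<in> V" "lt x z" by (auto simp: covered_by_def)
    have "graph_connected (hasse_edges V lt) z m"
      using less.IH[of z] card_above_less zV z less.prems(1) by blast
    moreover have "{x, z} \<in> hasse_edges V lt" using z by (auto simp: hasse_edges_def)
    ultimately show ?thesis unfolding graph_connected_def by (auto intro: converse_rtrancl_into_rtrancl)
  qed (simp add: graph_connected_def)
qed

text \<open>Crossing an edge upwards or downwards preserves the maximal element above, so a
  component cannot contain two roots.\<close>

lemma maximal_above_connected:
  assumes "graph_connected (hasse_edges V lt) x y" "x \<in> V"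
    "m \<in> maximal_elements V lt" "m = x \<or> lt x m"
  shows "y \<in> V \<and> (m = y \<or> lt y m)"
  using assms(1) unfolding graph_connected_def
proof (induction rule: rtrancl_induct)
  case (step y z)
  have m: "m \<in> V" "\<not> (\<exists>y\<in>V. lt m y)" using assms(3) by (auto simp: maximal_elements_def)
  have "covered_by V lt y z \<or> covered_by V lt z y" using step(2) hasse_edge_cases by blast
  then show ?case
    using step.IH m forest_chain[of y z m] forest_trans[of z y m] unfolding covered_by_def by blast
qed (use assms in simp)

lemma hasse_edges_rooted_forest:
  "rooted_forest V (hasse_edges V lt) (maximal_elements V lt)"
  unfolding rooted_forest_def
proof (intro conjI ballI)
  fix v assume v: "v \<in> V"
  obtain m where m: "m \<in> maximal_elements V lt" "m = v \<or> lt v m" using ex_maximal_above[OF v] by blast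
  show "\<exists>!r. r \<in> maximal_elements V lt \<and> graph_connected (hasse_edges V lt) v r"
  proof (rule ex1I)
    show "m \<in> maximal_elements V lt \<and> graph_connected (hasse_edges V lt) v m"
      using m connected_to_maximal v by blast
    fix r assume r: "r \<in> maximal_elements V lt \<and> graph_connected (hasse_edges V lt) v r"
    then have "r \<in> V" "m = r \<or> lt r m" using maximal_above_connected[of v r m] v m by auto
    then show "r = m" using r m by (auto simp: maximal_elements_def)
  qed
qed (use hasse_edges_simple_graph hasse_edges_acyclic in \<open>auto simp: maximal_elements_def\<close>)

end

text \<open>The edges are oriented from the roots downwards. If the second order reversed an edge
  with \<open>x\<close> below \<open>y\<close>, then \<open>y\<close> would not be a root, so it
  would have a cover \<open>c\<close> in the first order. By induction \<open>c\<close> covers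
  \<open>y\<close> in the second order too, hence \<open>c = x\<close>, against \<open>x\<close>
  below \<open>y\<close>.\<close>

lemma covered_by_determined:
  assumes "forest_order V lt" "forest_order V lt'"
    and edges: "hasse_edges V lt = hasse_edges V lt'"
    and roots: "maximal_elements V lt = maximal_elements V lt'"
  shows "covered_by V lt x y \<Longrightarrow> covered_by V lt' x y"
proof (induction x arbitrary: y rule: measure_induct_rule[of "\<lambda>x. card {z\<in>V. lt x z}"])
  case (less x)
  have xy: "x \<in> V" "y \<in> V" "lt x y" using less.prems by (auto simp: covered_by_def)
  have "{x, y} \<in> hasse_edges V lt" using less.prems by (auto simp: hasse_edges_def)
  then have "{x, y} \<in> hasse_edges V lt'" by (simp add: edges)
  moreover have "\<not> covered_by V lt' y x"
  proof
    assume yx: "covered_by V lt' y x"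
    then have "y \<notin> maximal_elements V lt" unfolding roots by (auto simp: maximal_elements_def covered_by_def)
    then obtain z where z: "z \<in> V" "lt y z" using xy by (auto simp: maximal_elements_def)
    then obtain c where c: "covered_by V lt y c" using ex_cover_below[OF assms(1) xy(2)] by metis
    have "covered_by V lt' y c" using less.IH[OF card_above_less[OF assms(1) xy] c] .
    then have "c = x" using covered_by_unique[OF assms(2)] yx by metis
    then have "lt y x" using c by (simp add: covered_by_def)
    then show False
      using forest_trans[OF assms(1), of x y x] forest_irrefl[OF assms(1), of x] xy by blast
  qed
  ultimately show ?case using hasse_edge_cases[OF assms(2)] by blast
qed

lemma forest_order_le_determined:
  assumes "forest_order V lt" "forest_order V lt'"
    and "hasse_edges V lt = hasse_edges V lt'" "maximal_elements V lt = maximal_elements V lt'"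
  shows "x \<in> V \<Longrightarrow> y \<in> V \<Longrightarrow> lt x y \<Longrightarrow> lt' x y"
proof (induction x rule: measure_induct_rule[of "\<lambda>x. card {z\<in>V. lt x z}"])
  case (less x)
  obtain z where z: "covered_by V lt x z" "z = y \<or> lt z y"
    using ex_cover_below[OF assms(1) less.prems] .
  then have zV: "z \<in> V" "lt x z" by (auto simp: covered_by_def)
  have "z = y \<or> lt' z y"
    using less.IH[OF card_above_less[OF assms(1) less.prems(1) zV] zV(1) less.prems(2)] z by blast
  moreover have "lt' x z"
    using covered_by_determined[OF assms z(1)] by (simp add: covered_by_def)
  ultimately show ?case using forest_trans[OF assms(2) less.prems(1) zV(1) less.prems(2)] by blast
qed

lemma forest_order_determined:
  assumes "forest_order V lt" "forest_order V lt'"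
    and "hasse_edges V lt = hasse_edges V lt'" "maximal_elements V lt = maximal_elements V lt'"
    and "x \<in> V" "y \<in> V"
  shows "lt x y \<longleftrightarrow> lt' x y"
  using forest_order_le_determined[OF assms(1-4)] forest_order_le_determined[OF assms(2,1)] assms by metis


section \<open>Orienting a rooted forest towards its roots\<close>

context
  fixes V :: "'a set" and F :: "'a set set" and R :: "'a set"
  assumes finite_V: "finite V" and rooted: "rooted_forest V F R"
begin

definition edge_rel :: "('a \<times> 'a) set" where
  "edge_rel = {(u, v). {u, v} \<in> F}"

definition depth :: "'a \<Rightarrow> nat" where
  "depth v = (LEAST k. \<exists>r\<in>R. (v, r) \<in> edge_rel ^^ k)"

text \<open>Some neighbour one step closer to a root; that it is the only one follows from
  acyclicity, through \<open>edge_cases\<close>. At a root the value is arbitrary, which is why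
  \<open>ancestor k v\<close> is used only for \<open>k \<le> depth v\<close>.\<close>

definition parent :: "'a \<Rightarrow> 'a" where
  "parent v = (SOME u. {v, u} \<in> F \<and> Suc (depth u) = depth v)"

definition ancestor :: "nat \<Rightarrow> 'a \<Rightarrow> 'a" where
  "ancestor k v = (parent ^^ k) v"

lemma edge_in_V: "{u, v} \<in> F \<Longrightarrow> u \<in> V \<and> v \<in> V \<and> u \<noteq> v"
  using rooted unfolding rooted_forest_def simple_graph_def by (metis doubleton_eq_iff)

lemma ex_root: "v \<in> V \<Longrightarrow> \<exists>k. \<exists>r\<in>R. (v, r) \<in> edge_rel ^^ k"
  using rooted unfolding rooted_forest_def graph_connected_def edge_rel_def
  by (metis rtrancl_imp_relpow)

lemma depth_path: "v \<in> V \<Longrightarrow> \<exists>r\<in>R. (v, r) \<in> edge_rel ^^ depth v"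
  unfolding depth_def using ex_root by (rule LeastI_ex)

lemma depth_le: "(v, r) \<in> edge_rel ^^ k \<Longrightarrow> r \<in> R \<Longrightarrow> depth v \<le> k"
  unfolding depth_def by (rule Least_le) blast

lemma depth_0_iff: "v \<in> V \<Longrightarrow> depth v = 0 \<longleftrightarrow> v \<in> R"
  using depth_path[of v] depth_le[of v v 0] by auto

lemma
  assumes "v \<in> V" "v \<notin> R"
  shows parent_edge: "{v, parent v} \<in> F" and depth_parent: "Suc (depth (parent v)) = depth v"
proof -
  obtain k where k: "depth v = Suc k" using depth_0_iff assms not0_implies_Suc by blast
  obtain r where r: "r \<in> R" "(v, r) \<in> edge_rel ^^ Suc k" using depth_path[OF assms(1)] k by auto
  obtain u where u: "(v, u) \<in> edge_rel" "(u, r) \<in> edge_rel ^^ k" using r relpow_Suc_D2 by metis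
  have uF: "{v, u} \<in> F" using u by (simp add: edge_rel_def)
  have "depth u \<le> k" using u r depth_le by blast
  moreover have "Suc (depth u) \<ge> depth v"
  proof -
    obtain r' where "r' \<in> R" "(u, r') \<in> edge_rel ^^ depth u" using depth_path edge_in_V uF by blast
    then show ?thesis using u(1) depth_le relpow_Suc_I2 by metis
  qed
  ultimately have "{v, u} \<in> F \<and> Suc (depth u) = depth v" using k uF by simp
  then have "{v, parent v} \<in> F \<and> Suc (depth (parent v)) = depth v"
    unfolding parent_def by (rule someI)
  then show "{v, parent v} \<in> F" "Suc (depth (parent v)) = depth v" by auto
qed

lemma ancestor_0 [simp]: "ancestor 0 v = v"
  and ancestor_Suc: "ancestor (Suc k) v = parent (ancestor k v)"
  and ancestor_add: "ancestor (j + k) v = ancestor j (ancestor k v)"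
  by (simp_all add: ancestor_def funpow_add)

lemma ancestor_depth:
  assumes "v \<in> V" "k \<le> depth v"
  shows "ancestor k v \<in> V \<and> depth (ancestor k v) = depth v - k"
  using assms(2)
proof (induction k)
  case (Suc k)
  then have k: "ancestor k v \<in> V" "depth (ancestor k v) = depth v - k" by auto
  then have "ancestor k v \<notin> R" using Suc depth_0_iff by force
  then have "{ancestor k v, ancestor (Suc k) v} \<in> F"
    "Suc (depth (ancestor (Suc k) v)) = depth (ancestor k v)"
    using parent_edge depth_parent k by (auto simp: ancestor_Suc)
  then show ?case using edge_in_V k Suc by fastforce
qed (use assms in simp)

lemma ancestor_edge:
  assumes "v \<in> V" "k < depth v"
  shows "{ancestor k v, ancestor (Suc k) v} \<in> F"
proof -
  have "ancestor k v \<in> V" "depth (ancestor k v) \<noteq> 0" using ancestor_depth[of v k] assms by auto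
  then show ?thesis using parent_edge depth_0_iff by (simp add: ancestor_Suc)
qed

lemma ancestor_inj:
  assumes "v \<in> V" "j \<le> depth v" "k \<le> depth v" "ancestor j v = ancestor k v"
  shows "j = k"
  using ancestor_depth[of v j] ancestor_depth[of v k] assms by auto

lemma ancestor_root: "v \<in> V \<Longrightarrow> ancestor (depth v) v \<in> R"
  using ancestor_depth[of v "depth v"] depth_0_iff by auto

lemma ancestor_connected:
  assumes "v \<in> V" "k \<le> depth v"
  shows "graph_connected F v (ancestor k v)"
  using assms(2)
proof (induction k)
  case (Suc k)
  then have "{ancestor k v, ancestor (Suc k) v} \<in> F" using ancestor_edge assms by simp
  then show ?case
    using Suc unfolding graph_connected_def by (auto intro: rtrancl_into_rtrancl)
qed (simp add: graph_connected_def)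

text \<open>Both chains of parents end in the single root of the common component, so the chains of
  adjacent vertices are certain to meet.\<close>

lemma root_of_adjacent:
  assumes "{x, y} \<in> F"
  shows "ancestor (depth x) x = ancestor (depth y) y"
proof -
  have V: "x \<in> V" "y \<in> V" using edge_in_V assms by auto
  have "graph_connected F y (ancestor (depth y) y)" using ancestor_connected V by blast
  then have "graph_connected F x (ancestor (depth y) y)"
    using assms unfolding graph_connected_def by (auto intro: converse_rtrancl_into_rtrancl)
  moreover have "graph_connected F x (ancestor (depth x) x)" using ancestor_connected V by blast
  ultimately show ?thesis
    using rooted V ancestor_root unfolding rooted_forest_def by blast
qed

text \<open>Climb from \<open>x\<close> to the meeting point, descend to \<open>y\<close>, and close
  up with the given edge. Minimality of \<open>j\<close> keeps the two legs disjoint, and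
  \<open>i + j \<ge> 2\<close> provides the three vertices that a cycle must have.\<close>

lemma cycle_of_common_ancestor:
  assumes edge: "{x, y} \<in> F" and i: "i \<le> depth x" and j: "j \<le> depth y"
    and eq: "ancestor i x = ancestor j y" and len: "i + j \<ge> 2"
    and min: "\<And>i' j'. i' \<le> i \<Longrightarrow> j' < j \<Longrightarrow> ancestor i' x \<noteq> ancestor j' y"
  shows "\<exists>xs. graph_cycle F xs"
proof -
  have V: "x \<in> V" "y \<in> V" using edge_in_V edge by auto
  define f where "f k = (if k \<le> i then ancestor k x else ancestor (i + j - k) y)" for k
  let ?xs = "map f [0..<Suc (i + j)]"
  have f_eq: "f k = ancestor (i + j - k) y" if "i \<le> k" "k \<le> i + j" for k
    using that eq by (cases "k = i") (auto simp: f_def)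
  have "inj_on f {0..<Suc (i + j)}"
  proof (rule linorder_inj_onI)
    fix k m assume km: "k < m" "k \<in> {0..<Suc (i + j)}" "m \<in> {0..<Suc (i + j)}"
    consider "m \<le> i" | "k \<le> i" "i < m" | "i < k" using km by linarith
    then show "f k \<noteq> f m"
    proof cases
      case 1
      then show ?thesis using km ancestor_inj[of x k m] V i by (auto simp: f_def)
    next
      case 2
      then show ?thesis using km min[of k "i + j - m"] by (auto simp: f_def)
    next
      case 3
      then have "i + j - k \<le> depth y" "i + j - m \<le> depth y" "i + j - k \<noteq> i + j - m"
        using km j by auto
      then show ?thesis
        using 3 km ancestor_inj[of y "i + j - k" "i + j - m"] V by (auto simp: f_def)
    qed
  qed auto
  then have "distinct ?xs" by (simp add: distinct_map del: upt_Suc)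
  moreover have "{?xs ! k, ?xs ! ((k + 1) mod length ?xs)} \<in> F" if "k < length ?xs" for k
  proof -
    have "k \<le> i + j" using that by (simp del: upt_Suc)
    then consider "k < i" | "i \<le> k" "k < i + j" | "k = i + j" by linarith
    then show ?thesis
    proof cases
      case 1
      then have "{f k, f (Suc k)} \<in> F" using ancestor_edge[of x k] V i by (simp add: f_def)
      then show ?thesis using 1 by (simp del: upt_Suc)
    next
      case 2
      then have "Suc (i + j - Suc k) = i + j - k" by simp
      then have "{f (Suc k), f k} \<in> F"
        using ancestor_edge[of y "i + j - Suc k"] V j 2 f_eq[of k] f_eq[of "Suc k"] by simp
      then show ?thesis using 2 by (simp add: insert_commute del: upt_Suc)
    next
      case 3
      then have "f k = y" "f 0 = x" using f_eq[of k] by (auto simp: f_def)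
      then show ?thesis using 3 edge by (simp add: insert_commute del: upt_Suc)
    qed
  qed
  moreover have "length ?xs \<ge> 3" using len by simp
  ultimately show ?thesis unfolding graph_cycle_def by blast
qed

text \<open>Otherwise the parent chains of \<open>x\<close> and \<open>y\<close>, followed to the
  first point of the chain of \<open>y\<close> that lies on the chain of \<open>x\<close>, close up
  to a cycle. The meetings too short for a cycle are \<open>x = y\<close>,
  \<open>parent x = y\<close> and \<open>parent y = x\<close>.\<close>

lemma edge_cases:
  assumes edge: "{x, y} \<in> F"
  shows "(x \<notin> R \<and> parent x = y) \<or> (y \<notin> R \<and> parent y = x)"
proof (rule ccontr)
  assume neg: "\<not> ?thesis"
  have V: "x \<in> V" "y \<in> V" "x \<noteq> y" using edge_in_V edge by auto
  define P where "P j \<longleftrightarrow> j \<le> depth y \<and> (\<exists>i\<le>depth x. ancestor i x = ancestor j y)" for j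
  have "P (depth y)" using root_of_adjacent[OF edge] by (auto simp: P_def)
  then obtain j where j: "P j" "\<And>j'. j' < j \<Longrightarrow> \<not> P j'"
    by (metis LeastI not_less_Least)
  then obtain i where i: "i \<le> depth x" "ancestor i x = ancestor j y" by (auto simp: P_def)
  have jy: "j \<le> depth y" using j by (simp add: P_def)
  have min: "ancestor i' x \<noteq> ancestor j' y" if "i' \<le> i" "j' < j" for i' j'
    using j(2)[OF that(2)] that i jy by (auto simp: P_def)
  have "\<not> i + j < 2"
  proof
    assume "i + j < 2"
    then consider "i = 0" "j = 0" | "i = 1" "j = 0" | "i = 0" "j = 1" by linarith
    then show False
    proof cases
      case 1 then show False using i V by simp
    next
      case 2
      then have "x \<notin> R" using i depth_0_iff[of x] V by auto
      then show False using 2 i neg by (simp add: ancestor_def)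
    next
      case 3
      then have "y \<notin> R" using jy depth_0_iff[of y] V by auto
      then show False using 3 i neg by (simp add: ancestor_def)
    qed
  qed
  then have "\<exists>xs. graph_cycle F xs" using cycle_of_common_ancestor[OF edge i(1) jy i(2) _ min] by simp
  then show False using rooted unfolding rooted_forest_def by blast
qed

definition below :: "'a \<Rightarrow> 'a \<Rightarrow> bool" where
  "below u v \<longleftrightarrow> u \<in> V \<and> (\<exists>k. 0 < k \<and> k \<le> depth u \<and> v = ancestor k u)"

lemma belowI: "u \<in> V \<Longrightarrow> 0 < k \<Longrightarrow> k \<le> depth u \<Longrightarrow> below u (ancestor k u)"
  by (auto simp: below_def)

lemma below_depth: "below u v \<Longrightarrow> v \<in> V \<and> depth v < depth u"
  using ancestor_depth unfolding below_def by fastforce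

lemma forest_order_below: "forest_order V below"
proof -
  have trans: "below x z" if xy: "below x y" and yz: "below y z" for x y z
  proof -
    obtain k where k: "x \<in> V" "0 < k" "k \<le> depth x" "y = ancestor k x" using xy below_def by blast
    obtain m where m: "0 < m" "m \<le> depth y" "z = ancestor m y" using yz below_def by blast
    have "z = ancestor (m + k) x" using k m by (simp add: ancestor_add)
    moreover have "m + k \<le> depth x" using ancestor_depth[of x k] k m by auto
    ultimately show ?thesis using belowI[of x "m + k"] k by simp
  qed
  have lt: "below (ancestor k x) (ancestor m x)" if "x \<in> V" "k < m" "m \<le> depth x" for x k m
  proof -
    have "ancestor m x = ancestor (m - k) (ancestor k x)" using that by (simp add: ancestor_add[symmetric])
    then show ?thesis using belowI[of "ancestor k x" "m - k"] ancestor_depth[of x k] that by simp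
  qed
  have chain: "y = z \<or> below y z \<or> below z y" if xy: "below x y" and xz: "below x z" for x y z
  proof -
    obtain k where k: "x \<in> V" "k \<le> depth x" "y = ancestor k x" using xy below_def by blast
    obtain m where m: "m \<le> depth x" "z = ancestor m x" using xz below_def by blast
    show ?thesis using lt k m by (metis linorder_neqE_nat)
  qed
  show ?thesis
    unfolding forest_order_def using finite_V below_depth trans chain by blast
qed

lemma covered_below_iff: "covered_by V below u v \<longleftrightarrow> u \<in> V \<and> u \<notin> R \<and> v = parent u"
proof
  assume c: "covered_by V below u v"
  then have u: "u \<in> V" "below u v" by (auto simp: covered_by_def)
  then obtain k where k: "0 < k" "k \<le> depth u" "v = ancestor k u" using below_def by blast
  then have nR: "u \<notin> R" using depth_0_iff u by force
  have "parent u = ancestor 1 u" by (simp add: ancestor_def)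
  then have p: "below u (parent u)" using belowI[of u 1] k u by simp
  have "\<not> below (parent u) v" using c p below_depth unfolding covered_by_def by blast
  moreover have "\<not> below v (parent u)"
  proof -
    have "depth v = depth u - k" "depth (parent u) = depth u - 1"
      using ancestor_depth[of u k] depth_parent[OF u(1) nR] k u by auto
    then show ?thesis using below_depth[of v "parent u"] k by fastforce
  qed
  ultimately have "v = parent u"
    using forest_chain[OF forest_order_below u(1) _ _ u(2) p] below_depth u p by blast
  then show "u \<in> V \<and> u \<notin> R \<and> v = parent u" using u nR by simp
next
  assume u: "u \<in> V \<and> u \<notin> R \<and> v = parent u"
  then have d: "Suc (depth v) = depth u" using depth_parent by blast
  have "v = ancestor 1 u" using u by (simp add: ancestor_def)
  then have "below u v" using belowI[of u 1] u d by simp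
  moreover have "\<not> (below u z \<and> below z v)" for z
    using below_depth[of u z] below_depth[of z v] d by linarith
  ultimately show "covered_by V below u v" using below_depth u by (auto simp: covered_by_def)
qed

lemma hasse_edges_below: "hasse_edges V below = F"
proof (intro equalityI subsetI)
  fix e assume "e \<in> F"
  moreover from this obtain x y where "e = {x, y}"
    using rooted unfolding rooted_forest_def simple_graph_def by metis
  ultimately show "e \<in> hasse_edges V below"
    using edge_cases[of x y] edge_in_V[of x y] unfolding hasse_edges_def covered_below_iff
    by (auto simp: insert_commute)
qed (use parent_edge in \<open>auto simp: hasse_edges_def covered_below_iff\<close>)

lemma maximal_elements_below: "maximal_elements V below = R"
proof -
  have "R \<subseteq> V" using rooted by (simp add: rooted_forest_def)
  moreover have "(\<exists>y\<in>V. below x y) \<longleftrightarrow> x \<notin> R" if "x \<in> V" for x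
  proof
    assume "\<exists>y\<in>V. below x y"
    then show "x \<notin> R" using below_depth depth_0_iff[OF that] by fastforce
  next
    assume "x \<notin> R"
    then have "covered_by V below x (parent x)" using covered_below_iff that by blast
    then show "\<exists>y\<in>V. below x y" by (auto simp: covered_by_def)
  qed
  ultimately show ?thesis unfolding maximal_elements_def by blast
qed

end

lemma rooted_forest_ex_order:
  assumes "finite V" "rooted_forest V F R"
  shows "\<exists>lt. forest_order V lt \<and> hasse_edges V lt = F \<and> maximal_elements V lt = R"
  using forest_order_below[OF assms] hasse_edges_below[OF assms] maximal_elements_below[OF assms] by blast


section \<open>The planar order of a labelled tree\<close>

text \<open>\<open>lt u v\<close> says that \<open>u\<close> is a proper descendant of
  \<open>v\<close>, and \<open>0\<close> is the root. Having \<open>lt\<close> false beyond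
  \<open>n\<close> takes the place of a carrier set.\<close>

locale tree_order =
  fixes n :: nat and lt :: "nat \<Rightarrow> nat \<Rightarrow> bool"
  assumes lt_bounded: "lt u v \<Longrightarrow> u \<le> n \<and> v \<le> n"
    and lt_irrefl: "\<not> lt u u"
    and lt_trans: "lt u v \<Longrightarrow> lt v w \<Longrightarrow> lt u w"
    and up_chain: "lt u v \<Longrightarrow> lt u w \<Longrightarrow> v = w \<or> lt v w \<or> lt w v"
    and lt_0: "0 < u \<Longrightarrow> u \<le> n \<Longrightarrow> lt u 0"
begin

abbreviation le :: "nat \<Rightarrow> nat \<Rightarrow> bool" where
  "le u v \<equiv> u = v \<or> lt u v"

definition height :: "nat \<Rightarrow> nat" where
  "height v = card {u. lt u v}"

text \<open>The branch at \<open>w\<close> that contains \<open>v\<close>. The value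
  \<open>w\<close> for \<open>v = w\<close> lets \<open>w\<close> be compared with its own
  children.\<close>

definition child :: "nat \<Rightarrow> nat \<Rightarrow> nat" where
  "child w v = (if v = w then w else THE x. lt x w \<and> le v x \<and> (\<forall>z. lt x z \<longrightarrow> \<not> lt z w))"

text \<open>Sorts \<open>w\<close> and its children from left to right: the children with larger label come first,
  then \<open>w\<close>, then the children with smaller label.\<close>

definition key :: "nat \<Rightarrow> nat \<Rightarrow> int" where
  "key w x = (if w < x then int x - int n - 1 else if x = w then 0 else int x + 1)"

text \<open>An in-order traversal: two vertices are compared where their branches part. The
  existential hides no choice, since by \<open>split_unique\<close> only one \<open>w\<close> can
  separate them.\<close>

definition before :: "nat \<Rightarrow> nat \<Rightarrow> bool" where
  "before u v \<longleftrightarrow> (\<exists>w. le u w \<and> le v w \<and> key w (child w u) < key w (child w v))"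

definition downset :: "nat \<Rightarrow> nat set" where
  "downset v = {u. le u v}"

definition pos :: "nat \<Rightarrow> nat" where
  "pos v = card {u. u = v \<or> before u v}"

lemma lt_asym: "lt u v \<Longrightarrow> \<not> lt v u"
  using lt_trans lt_irrefl by blast

lemma le_trans: "le u v \<Longrightarrow> le v w \<Longrightarrow> le u w"
  using lt_trans by blast

lemma le_chain: "le u v \<Longrightarrow> le u w \<Longrightarrow> v = w \<or> lt v w \<or> lt w v"
  using up_chain by blast

lemma le_0: "u \<le> n \<Longrightarrow> le u 0"
  using lt_0 by (cases "u = 0") auto

lemma finite_below: "finite {u. lt u v}"
  by (rule finite_subset[of _ "{..n}"]) (use lt_bounded in auto)

lemma height_less: "lt u v \<Longrightarrow> height u < height v"
  unfolding height_def
  by (rule psubset_card_mono[OF finite_below]) (use lt_trans lt_irrefl in blast)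

lemma child_unique:
  assumes "lt x w" "le v x" "\<forall>z. lt x z \<longrightarrow> \<not> lt z w"
    and "lt y w" "le v y" "\<forall>z. lt y z \<longrightarrow> \<not> lt z w"
  shows "x = y"
  using assms le_chain[of v x y] by blast

lemma child_eqI:
  assumes "lt x w" "le v x" "\<forall>z. lt x z \<longrightarrow> \<not> lt z w"
  shows "child w v = x"
proof -
  have "v \<noteq> w" using assms lt_trans lt_irrefl by blast
  moreover have "(THE x. lt x w \<and> le v x \<and> (\<forall>z. lt x z \<longrightarrow> \<not> lt z w)) = x"
    by (rule the_equality) (use assms child_unique in blast)+
  ultimately show ?thesis unfolding child_def by simp
qed

lemma child_self [simp]: "child w w = w"
  by (simp add: child_def)

lemma ex_child:
  assumes "lt v w"
  obtains x where "lt x w" "le v x" "\<forall>z. lt x z \<longrightarrow> \<not> lt z w"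
proof -
  let ?S = "{x. lt x w \<and> le v x}"
  have "v \<in> ?S" using assms by simp
  moreover have "\<forall>y. y \<in> ?S \<longrightarrow> height y < height w"
    using height_less by auto
  ultimately have "\<exists>x. x \<in> ?S \<and> (\<forall>y. y \<in> ?S \<longrightarrow> height y \<le> height x)"
    by (rule ex_has_greatest_nat[where P="\<lambda>y. y \<in> ?S"])
  then obtain x where x: "x \<in> ?S" and max: "\<forall>y. y \<in> ?S \<longrightarrow> height y \<le> height x"
    by blast
  have "\<not> lt z w" if "lt x z" for z
  proof
    assume "lt z w"
    then have "z \<in> ?S" using x le_trans[of v x z] that by simp
    then have "height z \<le> height x" using max by blast
    then show False using height_less[OF that] by simp
  qed
  then show ?thesis using that x by blast
qed

lemma
  assumes "lt v w"
  shows child_lt: "lt (child w v) w" and le_child: "le v (child w v)"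
    and child_covered: "lt (child w v) z \<Longrightarrow> \<not> lt z w"
  using ex_child[OF assms] child_eqI by metis+

lemma child_le: "le v w \<Longrightarrow> le (child w v) w"
  using child_lt by auto

lemma child_eq_self_iff: "le v w \<Longrightarrow> child w v = w \<longleftrightarrow> v = w"
  using child_lt[of v w] lt_irrefl[of w] by auto

lemma child_mono: "le u v \<Longrightarrow> lt v w \<Longrightarrow> child w u = child w v"
  by (rule child_eqI) (use child_lt le_child child_covered le_trans in blast)+

lemma child_bounded: "le v w \<Longrightarrow> w \<le> n \<Longrightarrow> child w v \<le> n"
  using child_le[of v w] lt_bounded[of "child w v" w] by auto

text \<open>For labels up to \<open>n\<close>, the value \<open>x - n - 1\<close> is negative and
  \<open>x + 1\<close> is positive, so the larger labels, \<open>w\<close> itself and the smaller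
  labels occupy separate ranges.\<close>

lemma key_inj: "x \<le> n \<Longrightarrow> y \<le> n \<Longrightarrow> key w x = key w y \<Longrightarrow> x = y"
  by (auto simp: key_def split: if_splits)

text \<open>Strictly above a common ancestor both vertices hang on the same child, so only the
  lowest common ancestor can separate them.\<close>

lemma split_unique:
  assumes "le u w" "le v w" "child w u \<noteq> child w v"
    and "le u w'" "le v w'" "child w' u \<noteq> child w' v"
  shows "w = w'"
proof -
  have "child b u = child b v" if "le u a" "le v a" "lt a b" for a b
    using child_mono[of u a b] child_mono[of v a b] that by simp
  then show ?thesis using assms le_chain[of u w w'] by blast
qed

lemma before_iff:
  assumes "le u w" "le v w" "child w u \<noteq> child w v"
  shows "before u v \<longleftrightarrow> key w (child w u) < key w (child w v)"
proof
  assume "before u v"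
  then obtain w' where "le u w'" "le v w'" "key w' (child w' u) < key w' (child w' v)"
    unfolding before_def by blast
  moreover have "w = w'"
    by (rule split_unique[OF assms calculation(1,2)]) (use calculation(3) in force)
  ultimately show "key w (child w u) < key w (child w v)" by simp
qed (use assms in \<open>auto simp: before_def\<close>)

text \<open>This is the lowest common ancestor, found as the common ancestor with the fewest
  descendants; \<open>0\<close> is always a candidate.\<close>

lemma ex_split:
  assumes "u \<le> n" "v \<le> n" "u \<noteq> v"
  obtains w where "w \<le> n" "le u w" "le v w" "child w u \<noteq> child w v"
proof -
  define w where "w = (ARG_MIN height w. le u w \<and> le v w)"
  have w: "le u w" "le v w" and min: "\<And>y. le u y \<and> le v y \<Longrightarrow> height w \<le> height y"
    using arg_min_nat_lemma[of "\<lambda>w. le u w \<and> le v w" 0 height] le_0 assms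
    unfolding w_def by blast+
  have "child w u \<noteq> child w v"
  proof
    assume eq: "child w u = child w v"
    show False
    proof (cases "u = w \<or> v = w")
      case True
      then show False using eq child_eq_self_iff w \<open>u \<noteq> v\<close> by metis
    next
      case False
      then have "lt u w" "lt v w" using w by auto
      then have "lt (child w u) w" "le u (child w u)" "le v (child w u)"
        using child_lt le_child eq by metis+
      then show False using min height_less not_le by blast
    qed
  qed
  moreover have "w \<le> n" using w lt_bounded assms by blast
  ultimately show ?thesis using that w by blast
qed

lemma before_irrefl: "\<not> before u u"
  by (simp add: before_def)

lemma before_bounded:
  assumes "before u v" shows "u \<le> n \<and> v \<le> n"
proof -
  obtain w where w: "le u w" "le v w" using assms before_def by blast
  moreover have "u \<noteq> v" using assms before_irrefl by blast
  ultimately show ?thesis using lt_bounded by blast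
qed

text \<open>The two separating vertices both lie above \<open>v\<close>, hence are comparable. If
  they differ, the higher one sees the vertices separated by the lower one in a single branch and
  decides alone.\<close>

lemma before_trans:
  assumes "before u v" "before v x"
  shows "before u x"
proof -
  obtain w where w: "le u w" "le v w" "key w (child w u) < key w (child w v)"
    using assms before_def by blast
  obtain w' where w': "le v w'" "le x w'" "key w' (child w' v) < key w' (child w' x)"
    using assms before_def by blast
  consider "w = w'" | "lt w w'" | "lt w' w" using le_chain w(2) w'(1) by blast
  then show ?thesis
  proof cases
    case 1
    then have "key w (child w u) < key w (child w x)" using w w' by simp
    then show ?thesis using 1 w w' unfolding before_def by blast
  next
    case 2
    then have "child w' u = child w' v" using child_mono[OF w(1) 2] child_mono[OF w(2) 2] by simp
    moreover have "le u w'" using w(1) 2 le_trans by blast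
    ultimately show ?thesis using w' unfolding before_def by metis
  next
    case 3
    then have "child w x = child w v" using child_mono[OF w'(1) 3] child_mono[OF w'(2) 3] by simp
    moreover have "le x w" using w'(2) 3 le_trans by blast
    ultimately show ?thesis using w unfolding before_def by metis
  qed
qed

lemma before_asym: "before u v \<Longrightarrow> \<not> before v u"
  using before_trans before_irrefl by blast

lemma before_total:
  assumes "u \<le> n" "v \<le> n" "u \<noteq> v"
  shows "before u v \<or> before v u"
proof -
  obtain w where w: "w \<le> n" "le u w" "le v w" "child w u \<noteq> child w v"
    using ex_split[OF assms] .
  then have "key w (child w u) \<noteq> key w (child w v)"
    using key_inj child_bounded by metis
  then have "key w (child w u) < key w (child w v) \<or> key w (child w v) < key w (child w u)"
    by linarith
  then show ?thesis using w unfolding before_def by blast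
qed

lemma
  assumes "lt q x"
  shows before_ancestor_iff: "before q x \<longleftrightarrow> x < child x q"
    and ancestor_before_iff: "before x q \<longleftrightarrow> child x q < x"
proof -
  have "child x q \<noteq> x" using assms child_lt lt_irrefl by metis
  moreover have "child x q \<le> n" "x \<le> n" using child_bounded assms lt_bounded by blast+
  ultimately show "before q x \<longleftrightarrow> x < child x q" "before x q \<longleftrightarrow> child x q < x"
    using before_iff[of q x x] before_iff[of x x q] assms by (auto simp: key_def)
qed

text \<open>Where the branch of an outside vertex \<open>y\<close> parts from that of
  \<open>v\<close>, the whole subtree of \<open>v\<close> hangs on one child, so \<open>y\<close>
  lies on one side of all of it.\<close>

lemma before_convex:
  assumes "le x v" "le z v" "before x y" "before y z"
  shows "le y v"
proof (rule ccontr)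
  assume y: "\<not> le y v"
  have "v \<le> n" using assms before_bounded[OF assms(3)] lt_bounded by blast
  then obtain w where w: "w \<le> n" "le v w" "le y w" "child w v \<noteq> child w y"
    using ex_split[of v y] y before_bounded[OF assms(3)] by metis
  then have "lt v w" using y by auto
  then have eq: "child w x = child w v" "child w z = child w v" and "le x w" "le z w"
    using child_mono assms le_trans by metis+
  then have "key w (child w x) < key w (child w y)" "key w (child w y) < key w (child w z)"
    using before_iff[of x w y] before_iff[of y w z] w assms(3,4) by auto
  then show False using eq by simp
qed

lemma finite_before: "finite {u. u = v \<or> before u v}"
  by (rule finite_subset[of _ "insert v {..n}"]) (use before_bounded in auto)

lemma pos_less: "before u v \<Longrightarrow> pos u < pos v"
  unfolding pos_def
proof (rule psubset_card_mono[OF finite_before])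
  assume uv: "before u v"
  then have "v \<notin> {x. x = u \<or> before x u}" using before_irrefl before_asym by auto
  then show "{x. x = u \<or> before x u} \<subset> {x. x = v \<or> before x v}"
    using uv before_trans by blast
qed

lemma pos_less_iff: "u \<le> n \<Longrightarrow> v \<le> n \<Longrightarrow> pos u < pos v \<longleftrightarrow> before u v"
  using before_total[of u v] pos_less[of u v] pos_less[of v u] by fastforce

lemma pos_inj: "inj_on pos {..n}"
  using before_total pos_less by (metis atMost_iff inj_onI less_irrefl)

lemma pos_range:
  assumes "v \<le> n" shows "pos v \<in> {1..Suc n}"
proof -
  have "{u. u = v \<or> before u v} \<subseteq> {..n}" using assms before_bounded by auto
  then have "pos v \<le> Suc n" unfolding pos_def using card_mono[of "{..n}"] by fastforce
  moreover have "pos v \<noteq> 0" unfolding pos_def using finite_before[of v] by auto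
  ultimately show ?thesis by simp
qed

lemma pos_image: "pos ` {..n} = {1..Suc n}"
  by (rule card_subset_eq) (use pos_range pos_inj in \<open>auto simp: card_image\<close>)

lemma downset_bounded: "v \<le> n \<Longrightarrow> downset v \<subseteq> {..n}"
  using lt_bounded by (auto simp: downset_def)

text \<open>Going up from \<open>v\<close> to \<open>u\<close>, the label drops at each step. This
  is the situation along a branch that always lies to the left of its ancestors.\<close>

lemma increasing_chain:
  assumes "lt v u" "\<And>x. lt v x \<Longrightarrow> le x u \<Longrightarrow> x < child x v"
  shows "u < v"
  using assms
proof (induction u rule: measure_induct_rule[of height])
  case (less u)
  have c: "lt (child u v) u" "le v (child u v)" using child_lt le_child less.prems by metis+
  have "u < child u v" using less.prems by blast
  moreover have "child u v < v" if "v \<noteq> child u v"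
    using less.IH[OF height_less[OF c(1)]] c less.prems(2) that le_trans by blast
  ultimately show ?case by force
qed

lemma decreasing_chain:
  assumes "lt v u" "\<And>x. lt v x \<Longrightarrow> le x u \<Longrightarrow> child x v < x"
  shows "v < u"
  using assms
proof (induction u rule: measure_induct_rule[of height])
  case (less u)
  have c: "lt (child u v) u" "le v (child u v)" using child_lt le_child less.prems by metis+
  have "child u v < u" using less.prems by blast
  moreover have "v < child u v" if "v \<noteq> child u v"
    using less.IH[OF height_less[OF c(1)]] c less.prems(2) that le_trans by blast
  ultimately show ?case by force
qed

section \<open>The intervals cut out by subtrees\<close>

definition left :: "nat \<Rightarrow> nat" where "left v = Min (pos ` downset v)"
definition right :: "nat \<Rightarrow> nat" where "right v = Max (pos ` downset v)"

context
  fixes v :: nat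
  assumes v: "v \<le> n"
begin

lemma finite_pos_downset: "finite (pos ` downset v)"
  using downset_bounded[OF v] finite_subset by blast

lemma obtain_left:
  obtains q where "le q v" "pos q = left v" "\<And>x. le x v \<Longrightarrow> pos q \<le> pos x"
proof -
  have "left v \<in> pos ` downset v"
    unfolding left_def by (rule Min_in[OF finite_pos_downset]) (auto simp: downset_def)
  then obtain q where q: "q \<in> downset v" "pos q = left v" by (metis imageE)
  moreover have "left v \<le> pos x" if "le x v" for x
    unfolding left_def by (rule Min_le[OF finite_pos_downset]) (use that in \<open>auto simp: downset_def\<close>)
  ultimately show ?thesis using that[of q] q by (simp add: downset_def)
qed

lemma obtain_right:
  obtains q where "le q v" "pos q = right v" "\<And>x. le x v \<Longrightarrow> pos x \<le> pos q"
proof -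
  have "right v \<in> pos ` downset v"
    unfolding right_def by (rule Max_in[OF finite_pos_downset]) (auto simp: downset_def)
  then obtain q where q: "q \<in> downset v" "pos q = right v" by (metis imageE)
  moreover have "pos x \<le> right v" if "le x v" for x
    unfolding right_def by (rule Max_ge[OF finite_pos_downset]) (use that in \<open>auto simp: downset_def\<close>)
  ultimately show ?thesis using that[of q] q by (simp add: downset_def)
qed

text \<open>There are no gaps: each value between the extremes is the position of some vertex, and
  convexity places that vertex in the subtree.\<close>

lemma interval_eq: "{left v..right v} = pos ` downset v"
proof (intro equalityI subsetI)
  fix k assume k: "k \<in> {left v..right v}"
  obtain x where x: "le x v" "pos x = left v" using obtain_left by metis
  obtain z where z: "le z v" "pos z = right v" using obtain_right by metis
  have b: "x \<le> n" "z \<le> n" using x z v lt_bounded by blast+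
  have "k \<in> {1..Suc n}" using k x z b pos_range[of x] pos_range[of z] by auto
  then obtain y where y: "y \<le> n" "k = pos y" using pos_image by (metis atMost_iff imageE)
  have "le y v"
  proof (cases "y = x \<or> y = z")
    case False
    then have "before x y" "before y z"
      using k x z y b before_total pos_less by (metis atLeastAtMost_iff not_le)+
    then show ?thesis using before_convex x z by blast
  qed (use x z in auto)
  then show "k \<in> pos ` downset v" using y by (auto simp: downset_def)
next
  fix k assume "k \<in> pos ` downset v"
  then show "k \<in> {left v..right v}"
    unfolding left_def right_def using finite_pos_downset by simp
qed

lemma left_le_right: "left v \<le> right v"
  using obtain_left obtain_right by metis

end

lemma downset_psubset_iff: "downset u \<subset> downset v \<longleftrightarrow> lt u v"
proof
  assume "downset u \<subset> downset v"
  then show "lt u v" unfolding downset_def by blast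
next
  assume uv: "lt u v"
  then have "v \<notin> downset u" using lt_irrefl lt_asym by (auto simp: downset_def)
  then show "downset u \<subset> downset v" using uv le_trans unfolding downset_def by blast
qed

lemma interval_psubset_iff:
  assumes "u \<le> n" "v \<le> n"
  shows "{left u..right u} \<subset> {left v..right v} \<longleftrightarrow> lt u v"
proof
  assume "lt u v"
  then show "{left u..right u} \<subset> {left v..right v}"
    using image_strict_mono[OF inj_on_subset[OF pos_inj downset_bounded[OF assms(2)]]]
    unfolding interval_eq[OF assms(1)] interval_eq[OF assms(2)] by (simp add: downset_psubset_iff)
next
  assume *: "{left u..right u} \<subset> {left v..right v}"
  then have "pos u \<in> pos ` downset v"
    unfolding interval_eq[OF assms(1)] interval_eq[OF assms(2)] by (auto simp: downset_def)
  then have "le u v"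
    using inj_on_image_mem_iff[OF pos_inj] assms downset_bounded by (simp add: downset_def)
  then show "lt u v" using * by auto
qed

lemma interval_disjoint:
  assumes "u \<le> n" "v \<le> n" "\<not> le u v" "\<not> le v u"
  shows "{left u..right u} \<inter> {left v..right v} = {}"
proof -
  have "downset u \<inter> downset v = {}" using le_chain assms by (auto simp: downset_def)
  then show ?thesis
    unfolding interval_eq[OF assms(1)] interval_eq[OF assms(2)]
    using inj_on_image_Int[OF pos_inj downset_bounded downset_bounded] assms by (metis image_empty)
qed

text \<open>The leftmost descendant \<open>q\<close> of \<open>v\<close> is then also leftmost below
  \<open>u\<close>. It precedes every \<open>x\<close> on the path from \<open>v\<close> to
  \<open>u\<close>, so at each such \<open>x\<close> the path arrives from the left, through a child
  with larger label.\<close>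

lemma left_label:
  assumes "lt v u" "left v = left u"
  shows "u < v"
proof (rule increasing_chain[OF assms(1)])
  fix x assume x: "lt v x" "le x u"
  have b: "u \<le> n" "v \<le> n" "x \<le> n" using assms x lt_bounded by blast+
  obtain q where q: "le q v" "pos q = left v" using obtain_left[OF b(2)] by metis
  have qx: "lt q x" using q x le_trans lt_trans by blast
  have "pos q \<le> pos x" using obtain_left[OF b(1)] x q assms by metis
  then have "before q x"
    using qx lt_irrefl before_total pos_less lt_bounded by (metis not_le)
  then show "x < child x v"
    using before_ancestor_iff[OF qx] child_mono q(1) x(1) by metis
qed

lemma right_label:
  assumes "lt v u" "right v = right u"
  shows "v < u"
proof (rule decreasing_chain[OF assms(1)])
  fix x assume x: "lt v x" "le x u"
  have b: "u \<le> n" "v \<le> n" "x \<le> n" using assms x lt_bounded by blast+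
  obtain q where q: "le q v" "pos q = right v" using obtain_right[OF b(2)] by metis
  have qx: "lt q x" using q x le_trans lt_trans by blast
  have "pos x \<le> pos q" using obtain_right[OF b(1)] x q assms by metis
  then have "before x q"
    using qx lt_irrefl before_total pos_less lt_bounded by (metis not_le)
  then show "child x v < x"
    using ancestor_before_iff[OF qx] child_mono q(1) x(1) by metis
qed

text \<open>At the vertex \<open>w\<close> where the branches part, adjacency leaves no room for
  another point between \<open>u\<close> and \<open>v\<close>. This gives three comparisons, from
  \<open>u\<close> to its branch, between the two branches, and from the branch of \<open>v\<close>
  to \<open>v\<close>, which combine to \<open>u < v\<close>.\<close>

lemma adjacent_label:
  assumes uv: "u \<le> n" "v \<le> n" "\<not> le u v" "\<not> le v u" and adj: "right u + 1 = left v"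
  shows "u < v"
proof -
  obtain q where q: "le q u" "pos q = right u" using obtain_right[OF uv(1)] by metis
  obtain s where s: "le s v" "pos s = left v" using obtain_left[OF uv(2)] by metis
  have b: "q \<le> n" "s \<le> n" using q s uv lt_bounded by blast+
  have gap: "\<not> (before q x \<and> before x s)" for x
    using pos_less[of q x] pos_less[of x s] q s adj by auto
  have qs: "before q s" using q s adj b pos_less_iff[of q s] by simp
  obtain w where w: "w \<le> n" "le u w" "le v w" "child w u \<noteq> child w v"
    using ex_split[of u v] uv by metis
  have uw: "lt u w" and vw: "lt v w" using w uv by auto
  have qw: "lt q w" and sw: "lt s w" using q s uw vw lt_trans by blast+
  have ch: "child w q = child w u" "child w s = child w v" using child_mono q s uw vw by metis+
  let ?u = "child w u" and ?v = "child w v"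
  have key: "key w ?u < key w ?v" using before_iff[of q w s] qw sw qs ch w by auto
  have ne: "?u \<noteq> w" "?v \<noteq> w" using child_lt[OF uw] child_lt[OF vw] lt_irrefl by auto
  \<comment> \<open>Otherwise \<open>u\<close> hangs to the left of \<open>w\<close> and
    \<open>v\<close> to its right, and \<open>w\<close> itself falls into the gap.\<close>
  have "?u < ?v"
  proof (rule ccontr)
    assume "\<not> ?u < ?v"
    then have "w < ?u \<and> ?v < w"
      using key ne child_bounded[OF w(2,1)] by (auto simp: key_def split: if_splits)
    then show False using gap[of w] before_ancestor_iff[OF qw] ancestor_before_iff[OF sw] ch by auto
  qed
  moreover have "u \<le> ?u"
  proof (cases "u = ?u")
    case False
    have "u < ?u"
    proof (rule decreasing_chain)
      show "lt u ?u" using False le_child[OF uw] by auto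
      fix x assume x: "lt u x" "le x ?u"
      have "lt x w" using x(2) child_lt[OF uw] lt_trans by metis
      moreover from this have "child w x = ?u" using child_mono[of u x w] x(1) by simp
      ultimately have xw: "lt x w" "child w x = ?u" by simp_all
      \<comment> \<open>\<open>x\<close> belongs to the branch of \<open>u\<close> at
        \<open>w\<close>, hence precedes \<open>s\<close>. As nothing lies between \<open>q\<close>
        and \<open>s\<close>, it must precede \<open>q\<close> as well, so \<open>u\<close> is on
        the right of \<open>x\<close>.\<close>
      have "before x s" using before_iff[of x w s] xw sw ch key w by auto
      then have "\<not> before q x" using gap by blast
      moreover have qx: "lt q x" using q x lt_trans by blast
      ultimately have "before x q"
        using before_total lt_irrefl lt_bounded by metis
      then show "child x u < x" using ancestor_before_iff[OF qx] child_mono[OF q(1) x(1)] by simp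
    qed
    then show ?thesis by simp
  qed simp
  moreover have "?v \<le> v"
  proof (cases "v = ?v")
    case False
    have "?v < v"
    proof (rule increasing_chain)
      show "lt v ?v" using False le_child[OF vw] by auto
      fix x assume x: "lt v x" "le x ?v"
      have "lt x w" using x(2) child_lt[OF vw] lt_trans by metis
      moreover from this have "child w x = ?v" using child_mono[of v x w] x(1) by simp
      ultimately have xw: "lt x w" "child w x = ?v" by simp_all
      have "before q x" using before_iff[of q w x] xw qw ch key w by auto
      then have "\<not> before x s" using gap by blast
      moreover have sx: "lt s x" using s x lt_trans by blast
      ultimately have "before s x"
        using before_total lt_irrefl lt_bounded by metis
      then show "x < child x v" using before_ancestor_iff[OF sx] child_mono[OF s(1) x(1)] by simp
    qed
    then show ?thesis by simp
  qed simp
  ultimately show ?thesis by simp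
qed

text \<open>Every label exceeds 0, so all children of the root lie to its left and its point comes
  last.\<close>

lemma pos_0: "pos 0 = Suc n"
proof -
  have "before u 0" if "u \<le> n" "u \<noteq> 0" for u
  proof -
    have u: "lt u 0" using lt_0 that by simp
    have "child 0 u \<noteq> 0" using child_lt[OF u] lt_irrefl by metis
    then show ?thesis using before_ancestor_iff[OF u] by simp
  qed
  then have "{u. u = 0 \<or> before u 0} = {..n}" using before_bounded by auto
  then show ?thesis unfolding pos_def by simp
qed

end


section \<open>Recovering the planar order from exceptional intervals\<close>

definition nested :: "nat \<Rightarrow> (nat \<Rightarrow> nat) \<Rightarrow> (nat \<Rightarrow> nat) \<Rightarrow> nat \<Rightarrow> nat \<Rightarrow> bool" where
  "nested n l r u v \<longleftrightarrow> u \<le> n \<and> v \<le> n \<and> {l u..r u} \<subset> {l v..r v}"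

text \<open>\<open>no_hom\<close> and \<open>no_ext\<close> are the vanishing criteria for maps and
  extensions from the later term \<open>j\<close> to the earlier term \<open>i\<close>.\<close>

locale exceptional_intervals =
  fixes n :: nat and l r :: "nat \<Rightarrow> nat"
  assumes l_pos: "u \<le> n \<Longrightarrow> 1 \<le> l u"
    and l_le_r: "u \<le> n \<Longrightarrow> l u \<le> r u"
    and r_le: "0 < u \<Longrightarrow> u \<le> n \<Longrightarrow> r u \<le> n"
    and l_0: "l 0 = 1" and r_0: "r 0 = Suc n"
    and no_hom: "i < j \<Longrightarrow> j \<le> n \<Longrightarrow> \<not> (l i \<le> l j \<and> l j \<le> r i \<and> r i \<le> r j)"
    and no_ext: "i < j \<Longrightarrow> j \<le> n \<Longrightarrow> \<not> (l j < l i \<and> l i \<le> r j + 1 \<and> r j + 1 \<le> r i)"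
begin

abbreviation "lt \<equiv> nested n l r"

lemma lt_iff: "lt u v \<longleftrightarrow> u \<le> n \<and> v \<le> n \<and> l v \<le> l u \<and> r u \<le> r v \<and> (l u \<noteq> l v \<or> r u \<noteq> r v)"
  unfolding nested_def psubset_eq using l_le_r by (auto simp: Icc_eq_Icc)

text \<open>Of two properly overlapping intervals, the later one either starts further right and
  violates the Hom condition, or starts further left and violates the Ext condition. Equal intervals
  violate the Hom condition.\<close>

lemma laminar:
  assumes "u \<le> n" "v \<le> n" "u \<noteq> v"
  shows "r u < l v \<or> r v < l u \<or> lt u v \<or> lt v u"
proof -
  have *: "r i < l j \<or> r j < l i \<or> lt i j \<or> lt j i" if "i < j" "j \<le> n" for i j
  proof (cases "l i \<le> l j")
    case True
    then show ?thesis unfolding lt_iff using no_hom[OF that] that by linarith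
  next
    case False
    then show ?thesis unfolding lt_iff using no_ext[OF that] that by linarith
  qed
  show ?thesis using assms *[of u v] *[of v u] by (meson linorder_neqE_nat)
qed

text \<open>With a common left end the shorter module is a quotient of the longer one, and this
  nonzero map must not go from a later to an earlier term. In \<open>child_right_label\<close> it is
  a submodule instead, which reverses the order.\<close>

lemma child_left_label: "lt u v \<Longrightarrow> l u = l v \<Longrightarrow> v < u"
  using no_hom[of u v] l_le_r[of u] unfolding lt_iff by (metis le_refl linorder_neqE_nat)

lemma child_right_label: "lt u v \<Longrightarrow> r u = r v \<Longrightarrow> u < v"
  using no_hom[of v u] l_le_r[of u] unfolding lt_iff by (metis le_refl linorder_neqE_nat)

text \<open>The module of the union is a non-split extension of the left module by the right one, so
  the left term has to come first.\<close>

lemma adjacent_increasing: "u \<le> n \<Longrightarrow> v \<le> n \<Longrightarrow> r u + 1 = l v \<Longrightarrow> u < v"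
  using no_ext[of v u] l_le_r[of u] l_le_r[of v]
  by (metis add.commute le_add2 le_less_trans less_add_one linorder_neqE_nat not_le order_le_less)

sublocale tree_order n "nested n l r"
proof
  show "v = w \<or> lt v w \<or> lt w v" if "lt u v" "lt u w" for u v w
  proof -
    have "\<not> r v < l w" "\<not> r w < l v" "v \<le> n" "w \<le> n"
      using that l_le_r[of u] unfolding lt_iff by linarith+
    then show ?thesis using laminar[of v w] by blast
  qed
  show "lt u 0" if "0 < u" "u \<le> n" for u
    using that l_pos[of u] r_le[of u] l_0 r_0 unfolding lt_iff by auto
qed (auto simp: nested_def)

definition hole :: "nat \<Rightarrow> nat \<Rightarrow> bool" where
  "hole w p \<longleftrightarrow> p \<in> {l w..r w} \<and> (\<forall>x. lt x w \<longrightarrow> p \<notin> {l x..r x})"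

lemma ex_child_at:
  assumes "p \<in> {l w..r w}" "\<not> hole w p"
  obtains x where "lt x w" "p \<in> {l x..r x}" "\<forall>z. lt x z \<longrightarrow> \<not> lt z w"
proof -
  obtain y where y: "lt y w" "p \<in> {l y..r y}" using assms hole_def by blast
  obtain x where "lt x w" "le y x" "\<forall>z. lt x z \<longrightarrow> \<not> lt z w" using ex_child[OF y(1)] .
  moreover have "p \<in> {l x..r x}" using y \<open>le y x\<close> lt_iff by force
  ultimately show ?thesis using that by blast
qed

lemma child_at_unique:
  assumes "lt x w" "p \<in> {l x..r x}" "\<forall>z. lt x z \<longrightarrow> \<not> lt z w"
    "lt y w" "p \<in> {l y..r y}" "\<forall>z. lt y z \<longrightarrow> \<not> lt z w"
  shows "x = y"
  using laminar[of x y] assms lt_bounded[OF assms(1)] lt_bounded[OF assms(4)] by fastforce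

text \<open>Walk from \<open>p\<close> to \<open>q\<close>. Each point that is not a hole lies in
  exactly one maximal subinterval, and when that subinterval changes, the new one is adjacent to the
  old one, so the label grows.\<close>

lemma children_increasing:
  assumes "lt x w" "p \<in> {l x..r x}" "\<forall>z. lt x z \<longrightarrow> \<not> lt z w"
    and "lt y w" "q \<in> {l y..r y}" "\<forall>z. lt y z \<longrightarrow> \<not> lt z w"
    and "p \<le> q" "\<And>k. p \<le> k \<Longrightarrow> k \<le> q \<Longrightarrow> \<not> hole w k"
  shows "x \<le> y"
  using assms(7,4-6,8)
proof (induction q arbitrary: y rule: dec_induct)
  case base
  then show ?case using child_at_unique[of x w p y] assms by simp
next
  case (step k)
  have "k \<in> {l w..r w}"
    using step assms(1,2) unfolding lt_iff by auto
  moreover have "\<not> hole w k" using step by simp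
  ultimately obtain c where c: "lt c w" "k \<in> {l c..r c}" "\<forall>z. lt c z \<longrightarrow> \<not> lt z w"
    using ex_child_at by blast
  have xc: "x \<le> c" using step.IH[OF c] step.prems by simp
  show ?case
  proof (cases "c = y")
    case False
    have b: "c \<le> n" "y \<le> n" using c step.prems lt_bounded by blast+
    then have "r c < l y" using laminar[OF b False] c step.prems False by fastforce
    then have "r c + 1 = l y" using c step.prems by auto
    then show ?thesis using adjacent_increasing b xc by fastforce
  qed (use xc in simp)
qed

text \<open>The child containing the left end of \<open>w\<close> shares that end, hence has a label
  above \<open>w\<close>; from there to \<open>x\<close> the labels do not decrease.\<close>

lemma left_of_hole:
  assumes "lt x w" "p \<in> {l x..r x}" "\<forall>z. lt x z \<longrightarrow> \<not> lt z w"
    and "\<And>k. l w \<le> k \<Longrightarrow> k \<le> p \<Longrightarrow> \<not> hole w k"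
  shows "w < x"
proof -
  have w: "w \<le> n" "l w \<le> r w" "l w \<le> p" using assms lt_iff l_le_r by auto
  then obtain c where c: "lt c w" "l w \<in> {l c..r c}" "\<forall>z. lt c z \<longrightarrow> \<not> lt z w"
    using ex_child_at[of "l w" w] assms(4)[of "l w"] by (metis atLeastAtMost_iff order_refl)
  have "w < c" using child_left_label[OF c(1)] c lt_iff by force
  also have "c \<le> x" using children_increasing[OF c assms(1-3)] w assms(4) by blast
  finally show ?thesis .
qed

lemma right_of_hole:
  assumes "lt x w" "p \<in> {l x..r x}" "\<forall>z. lt x z \<longrightarrow> \<not> lt z w"
    and "\<And>k. p \<le> k \<Longrightarrow> k \<le> r w \<Longrightarrow> \<not> hole w k"
  shows "x < w"
proof -
  have w: "w \<le> n" "l w \<le> r w" "p \<le> r w" using assms lt_iff l_le_r by auto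
  then obtain c where c: "lt c w" "r w \<in> {l c..r c}" "\<forall>z. lt c z \<longrightarrow> \<not> lt z w"
    using ex_child_at[of "r w" w] assms(4)[of "r w"] by (metis atLeastAtMost_iff order_refl)
  have "x \<le> c" using children_increasing[OF assms(1-3) c] w assms(4) by blast
  also have "c < w" using child_right_label[OF c(1)] c lt_iff by force
  finally show ?thesis .
qed

text \<open>Without a hole the child at the left end would be left and right of every hole
  vacuously, so its label would be both larger and smaller than \<open>w\<close>.\<close>

lemma ex_hole:
  assumes "w \<le> n" shows "\<exists>p. hole w p"
proof (rule ccontr)
  assume no: "\<nexists>p. hole w p"
  then obtain c where c: "lt c w" "l w \<in> {l c..r c}" "\<forall>z. lt c z \<longrightarrow> \<not> lt z w"
    using ex_child_at[of "l w" w] l_le_r[OF assms] by (metis atLeastAtMost_iff order_refl)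
  show False using left_of_hole[OF c] right_of_hole[OF c] no by fastforce
qed

lemma hole_disjoint:
  assumes "hole u p" "hole v p" "u \<le> n" "v \<le> n"
  shows "u = v"
  using laminar[of u v] assms unfolding hole_def by fastforce

definition the_hole :: "nat \<Rightarrow> nat" where "the_hole w = (SOME p. hole w p)"

lemma hole_the_hole: "w \<le> n \<Longrightarrow> hole w (the_hole w)"
  unfolding the_hole_def using ex_hole by (rule someI_ex)

lemma interval_range: "u \<le> n \<Longrightarrow> {l u..r u} \<subseteq> {1..Suc n}"
  using l_pos[of u] r_le[of u] r_0 by (cases "u = 0") auto

lemma the_hole_inj: "inj_on the_hole {..n}"
  using hole_disjoint hole_the_hole by (metis atMost_iff inj_onI)

text \<open>The holes of the \<open>n + 1\<close> indices are distinct points of a set with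
  \<open>n + 1\<close> elements, so they exhaust it. This count is what makes the hole of each
  interval unique in \<open>hole_iff\<close>.\<close>

lemma the_hole_image: "the_hole ` {..n} = {1..Suc n}"
proof (rule card_subset_eq)
  show "the_hole ` {..n} \<subseteq> {1..Suc n}"
    using hole_the_hole interval_range unfolding hole_def by (metis atMost_iff image_subsetI subsetD)
qed (simp_all add: card_image the_hole_inj)

lemma hole_iff:
  assumes "w \<le> n" shows "hole w p \<longleftrightarrow> p = the_hole w"
proof
  assume h: "hole w p"
  then have "p \<in> {1..Suc n}" using interval_range[OF assms] unfolding hole_def by blast
  then obtain u where u: "u \<le> n" "p = the_hole u" using the_hole_image by (metis atMost_iff imageE)
  then show "p = the_hole w" using hole_disjoint h hole_the_hole assms by metis
qed (use hole_the_hole assms in simp)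

text \<open>A point \<open>p\<close> is the hole of some \<open>u\<close>. If \<open>p\<close> lies
  in the interval of \<open>v\<close>, that interval meets the one of \<open>u\<close> and cannot be
  properly inside it, since it would cover the hole; so \<open>u\<close> is below or equal to
  \<open>v\<close>.\<close>

lemma interval_eq_the_hole:
  assumes "v \<le> n" shows "{l v..r v} = the_hole ` downset v"
proof (intro equalityI subsetI)
  fix p assume p: "p \<in> {l v..r v}"
  then have "p \<in> {1..Suc n}" using interval_range[OF assms] by blast
  then obtain u where u: "u \<le> n" "p = the_hole u" using the_hole_image by (metis atMost_iff imageE)
  then have "hole u p" using hole_iff by simp
  then have "le u v" using p laminar[of u v] u assms unfolding hole_def by fastforce
  then show "p \<in> the_hole ` downset v" using u by (auto simp: downset_def)
next
  fix p assume "p \<in> the_hole ` downset v"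
  then obtain u where u: "le u v" "p = the_hole u" by (auto simp: downset_def)
  then have "p \<in> {l u..r u}" using hole_the_hole assms lt_bounded unfolding hole_def by blast
  then show "p \<in> {l v..r v}" using u lt_iff by force
qed

lemma
  assumes "lt x w" "p \<in> {l x..r x}" "\<forall>z. lt x z \<longrightarrow> \<not> lt z w"
  shows less_hole_iff: "p < the_hole w \<longleftrightarrow> w < x"
    and greater_hole_iff: "the_hole w < p \<longleftrightarrow> x < w"
proof -
  have w: "w \<le> n" using assms lt_bounded by blast
  have "p \<noteq> the_hole w" using hole_the_hole[OF w] assms unfolding hole_def by blast
  then consider "p < the_hole w" | "the_hole w < p" by linarith
  then show "p < the_hole w \<longleftrightarrow> w < x" "the_hole w < p \<longleftrightarrow> x < w"
    using left_of_hole[OF assms] right_of_hole[OF assms] hole_iff[OF w]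
    by (metis less_asym not_le)+
qed

text \<open>The order computed from labels agrees with the actual order of the points. Both are
  decided at the vertex \<open>w\<close> separating \<open>u\<close> and \<open>v\<close>, where the
  side of a child relative to the hole of \<open>w\<close> is read off from its label.\<close>

lemma before_the_hole:
  assumes "before u v"
  shows "the_hole u < the_hole v"
proof -
  obtain w where w: "le u w" "le v w" "key w (child w u) < key w (child w v)"
    using assms before_def by blast
  have b: "u \<le> n" "v \<le> n" "w \<le> n" using before_bounded[OF assms] w lt_bounded by blast+
  let ?u = "child w u" and ?v = "child w v"
  have in_child: "the_hole y \<in> {l (child w y)..r (child w y)}" if "lt y w" for y
    using interval_eq_the_hole[of "child w y"] le_child[OF that] child_lt[OF that] lt_bounded
    by (auto simp: downset_def)
  have u: "lt ?u w" "the_hole u \<in> {l ?u..r ?u}" "\<forall>z. lt ?u z \<longrightarrow> \<not> lt z w" if "u \<noteq> w"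
    using in_child child_lt[of u w] child_covered[of u w] w that by auto
  have v: "lt ?v w" "the_hole v \<in> {l ?v..r ?v}" "\<forall>z. lt ?v z \<longrightarrow> \<not> lt z w" if "v \<noteq> w"
    using in_child child_lt[of v w] child_covered[of v w] w that by auto
  consider "u = w" "v \<noteq> w" | "u \<noteq> w" "v = w" | "u \<noteq> w" "v \<noteq> w" using w by auto
  then show ?thesis
  proof cases
    case 1
    then show ?thesis
      using greater_hole_iff[OF v] w(3) child_bounded[OF w(2) b(3)] by (auto simp: key_def split: if_splits)
  next
    case 2
    then show ?thesis
      using less_hole_iff[OF u] w(3) child_bounded[OF w(1) b(3)] by (auto simp: key_def split: if_splits)
  next
    case 3
    have ne: "?u \<noteq> w" "?v \<noteq> w" using u(1) v(1) 3 lt_irrefl by force+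
    show ?thesis
    proof (cases "?u < ?v")
      case False
      then have "w < ?u" "?v < w"
        using w(3) ne child_bounded[OF w(1) b(3)] by (auto simp: key_def split: if_splits)
      then show ?thesis using less_hole_iff[OF u] greater_hole_iff[OF v] 3 by force
    next
      case True
      show ?thesis
      proof (rule ccontr)
        assume "\<not> the_hole u < the_hole v"
        then have le: "the_hole v \<le> the_hole u" by simp
        \<comment> \<open>If no hole of \<open>w\<close> lay between them, the labels of the
          branches would be ordered the other way. So the hole of \<open>w\<close> does lie between,
          which puts the two branches on sides that contradict the keys.\<close>
        have "\<exists>k. the_hole v \<le> k \<and> k \<le> the_hole u \<and> hole w k"
          using children_increasing[OF v u le] 3 True by fastforce
        then have "the_hole v \<le> the_hole w" "the_hole w \<le> the_hole u" using hole_iff[OF b(3)] by auto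
        moreover have "the_hole v \<noteq> the_hole w" "the_hole u \<noteq> the_hole w"
          using the_hole_inj b 3 by (auto simp: inj_on_def)
        ultimately have "w < ?v" "?u < w"
          using less_hole_iff[OF v] greater_hole_iff[OF u] 3 by auto
        then show False using w(3) child_bounded[OF w(2) b(3)] by (auto simp: key_def)
      qed
    qed
  qed
qed

text \<open>A monotone bijection from the vertices onto \<open>{1..Suc n}\<close> is the rank
  function.\<close>

lemma the_hole_eq_pos:
  assumes "v \<le> n" shows "the_hole v = pos v"
proof -
  have "the_hole ` {u. u = v \<or> before u v} = {1..the_hole v}"
  proof (intro equalityI subsetI)
    fix k assume "k \<in> the_hole ` {u. u = v \<or> before u v}"
    then obtain u where u: "k = the_hole u" "u = v \<or> before u v" by auto
    then have "k \<in> {1..Suc n}" using the_hole_image before_bounded assms by blast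
    then show "k \<in> {1..the_hole v}" using u before_the_hole by force
  next
    fix k assume k: "k \<in> {1..the_hole v}"
    moreover have "the_hole v \<le> Suc n" using the_hole_image assms by (metis atLeastAtMost_iff atMost_iff imageI)
    ultimately have "k \<in> {1..Suc n}" by auto
    then obtain u where u: "u \<le> n" "k = the_hole u" using the_hole_image by (metis atMost_iff imageE)
    then have "u = v \<or> before u v"
      using before_total[of u v] before_the_hole[of v u] assms k by fastforce
    then show "k \<in> the_hole ` {u. u = v \<or> before u v}" using u by auto
  qed
  then have "card (the_hole ` {u. u = v \<or> before u v}) = the_hole v" by simp
  moreover have "inj_on the_hole {u. u = v \<or> before u v}"
    by (rule inj_on_subset[OF the_hole_inj]) (use before_bounded assms in auto)
  ultimately show ?thesis unfolding pos_def by (simp add: card_image)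
qed

lemma interval_eq_pos: "v \<le> n \<Longrightarrow> {l v..r v} = pos ` downset v"
  using interval_eq_the_hole[of v] the_hole_eq_pos downset_bounded[of v] by (metis atMost_iff image_cong subsetD)

end

lemma exceptional_intervals_unique:
  assumes "exceptional_intervals n l r" "exceptional_intervals n l' r'"
    and "nested n l r = nested n l' r'" "v \<le> n"
  shows "l v = l' v \<and> r v = r' v"
proof -
  have "{l v..r v} = {l' v..r' v}"
    using exceptional_intervals.interval_eq_pos assms by metis
  then show ?thesis
    using exceptional_intervals.l_le_r[OF assms(1,4)] by (simp add: Icc_eq_Icc)
qed

section \<open>The intervals of a labelled tree are exceptional\<close>

context tree_order
begin

text \<open>For nested intervals a violation forces a common endpoint, excluded by
  \<open>left_label\<close> or \<open>right_label\<close>. For disjoint ones it forces the interval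
  of \<open>j\<close> to end just before that of \<open>i\<close>, excluded by
  \<open>adjacent_label\<close>.\<close>

lemma exceptional_intervals: "exceptional_intervals n left right"
proof
  show b1: "1 \<le> left u" if u: "u \<le> n" for u
    using obtain_left[OF u] pos_range u lt_bounded by (metis atLeastAtMost_iff)
  show lr: "left u \<le> right u" if u: "u \<le> n" for u
    using left_le_right[OF u] .
  show "right u \<le> n" if u: "0 < u" "u \<le> n" for u
  proof -
    obtain q where q: "le q u" "pos q = right u" using obtain_right[OF u(2)] by metis
    have "q \<le> n" using q u lt_bounded by blast
    have "q \<noteq> 0" using q u lt_0[of u] lt_asym[of u 0] by (metis less_irrefl)
    then have "pos q \<noteq> pos 0" using inj_onD[OF pos_inj, of q 0] \<open>q \<le> n\<close> by auto
    then show ?thesis using q pos_0 pos_range[OF \<open>q \<le> n\<close>] by auto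
  qed
  have "downset 0 = {..n}" using le_0 lt_bounded by (auto simp: downset_def)
  then have "{left 0..right 0} = {1..Suc n}" using interval_eq[of 0] pos_image by simp
  then show "left 0 = 1" "right 0 = Suc n" by (auto simp: Icc_eq_Icc)
  fix i j :: nat assume ij: "i < j" "j \<le> n"
  then have b: "i \<le> n" "j \<le> n" by auto
  have nest: "left v \<le> left u \<and> right u \<le> right v" if "lt u v" for u v
    using interval_psubset_iff[of u v] lt_bounded[OF that] lr[of u] that by auto
  have "\<not> (left i \<le> left j \<and> left j \<le> right i \<and> right i \<le> right j) \<and>
    \<not> (left j < left i \<and> left i \<le> right j + 1 \<and> right j + 1 \<le> right i)"
  proof -
    consider "lt i j" | "lt j i" | "\<not> le i j" "\<not> le j i" using ij by auto
    then show ?thesis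
    proof cases
      case 1
      then show ?thesis using nest[OF 1] left_label[OF 1] ij by auto
    next
      case 2
      then show ?thesis using nest[OF 2] right_label[OF 2] ij by auto
    next
      case 3
      have "right i < left j \<or> right j < left i"
        using interval_disjoint[OF b 3] lr[OF b(1)] lr[OF b(2)] by auto
      moreover have "right j + 1 \<noteq> left i" using adjacent_label[of j i] b 3 ij by auto
      ultimately show ?thesis using lr[OF b(1)] lr[OF b(2)] by auto
    qed
  qed
  then show "\<not> (left i \<le> left j \<and> left j \<le> right i \<and> right i \<le> right j)"
    "\<not> (left j < left i \<and> left i \<le> right j + 1 \<and> right j + 1 \<le> right i)" by auto
qed

lemma nested_left_right: "nested n left right = lt"
proof (intro ext)
  show "nested n left right u v = lt u v" for u v
    using interval_psubset_iff[of u v] lt_bounded[of u v] unfolding nested_def by blast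
qed

end


section \<open>Exceptional sequences and forests\<close>

text \<open>Self-extensions vanish because the criterion would ask for \<open>l i < l i\<close>, so
  the pairs \<open>i < j\<close> carry all the content. The endpoints at index 0 are overwritten by
  those of the artificial root.\<close>

lemma complete_exceptional_sequence_iff:
  assumes rep: "\<And>i. i \<in> {1..n} \<Longrightarrow> interval_rep n (E i) (l i) (r i) (e i)"
  shows "complete_exceptional_sequence n E \<longleftrightarrow>
    exceptional_intervals n (l(0 := 1)) (r(0 := Suc n))"
proof -
  have two: "two_interval_reps n (E j) (E i) (l j) (r j) (l i) (r i) (e j) (e i)"
    if "i \<in> {1..n}" "j \<in> {1..n}" for i j
    using rep that by (simp add: two_interval_reps_def)
  have bounds: "1 \<le> l i" "l i \<le> r i" "r i \<le> n" if "i \<in> {1..n}" for i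
    using interval_rep.bounds[OF rep[OF that]] by simp_all
  have hom: "Hom_zero n (E j) (E i) \<longleftrightarrow> \<not> (l i \<le> l j \<and> l j \<le> r i \<and> r i \<le> r j)"
    and ext: "Ext_zero n (E j) (E i) \<longleftrightarrow> \<not> (l j < l i \<and> l i \<le> r j + 1 \<and> r j + 1 \<le> r i)"
    if "i \<in> {1..n}" "j \<in> {1..n}" for i j
    using two_interval_reps.Hom_zero_iff[OF two[OF that]] two_interval_reps.Ext_zero_iff[OF two[OF that]]
    by simp_all
  have "complete_exceptional_sequence n E \<longleftrightarrow>
    (\<forall>i\<in>{1..n}. \<forall>j\<in>{1..n}. i < j \<longrightarrow> Hom_zero n (E j) (E i) \<and> Ext_zero n (E j) (E i))"
    unfolding complete_exceptional_sequence_def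
    using interval_rep.rep[OF rep] interval_rep.indecomposable[OF rep] ext by simp
  also have "\<dots> \<longleftrightarrow> exceptional_intervals n (l(0 := 1)) (r(0 := Suc n))" (is "?L \<longleftrightarrow> ?R")
  proof
    assume ?L
    then show ?R
    proof unfold_locales
      fix i j :: nat assume ij: "i < j" "j \<le> n"
      then have j: "j \<in> {1..n}" "j \<noteq> 0" by auto
      let ?l = "l(0 := 1)" and ?r = "r(0 := Suc n)"
      have "\<not> (?l i \<le> ?l j \<and> ?l j \<le> ?r i \<and> ?r i \<le> ?r j) \<and>
        \<not> (?l j < ?l i \<and> ?l i \<le> ?r j + 1 \<and> ?r j + 1 \<le> ?r i)"
      proof (cases "i = 0")
        case True
        then show ?thesis using bounds[OF j(1)] j(2) by auto
      next
        case False
        then have i: "i \<in> {1..n}" using ij by auto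
        then have "Hom_zero n (E j) (E i)" "Ext_zero n (E j) (E i)" using \<open>?L\<close> j(1) ij(1) by blast+
        then show ?thesis using False j(2) hom[OF i j(1)] ext[OF i j(1)] by simp
      qed
      then show "\<not> (?l i \<le> ?l j \<and> ?l j \<le> ?r i \<and> ?r i \<le> ?r j)"
        "\<not> (?l j < ?l i \<and> ?l i \<le> ?r j + 1 \<and> ?r j + 1 \<le> ?r i)" by blast+
    qed (use bounds in auto)
  next
    assume R: ?R
    show ?L
    proof (intro ballI impI)
      fix i j assume ij: "i \<in> {1..n}" "j \<in> {1..n}" "i < j"
      then show "Hom_zero n (E j) (E i) \<and> Ext_zero n (E j) (E i)"
        using exceptional_intervals.no_hom[OF R, of i j] exceptional_intervals.no_ext[OF R, of i j]
          hom ext by simp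
    qed
  qed
  finally show ?thesis .
qed

lemma complete_exceptional_sequence_intervals:
  assumes "complete_exceptional_sequence n E"
  obtains l r e where "\<And>i. i \<in> {1..n} \<Longrightarrow> interval_rep n (E i) (l i) (r i) (e i)"
    "exceptional_intervals n (l(0 := 1)) (r(0 := Suc n))"
proof -
  have "\<forall>i\<in>{1..n}. \<exists>a b e. interval_rep n (E i) a b e"
    using assms indecomposable_interval_rep unfolding complete_exceptional_sequence_def by blast
  then obtain l r e where "\<And>i. i \<in> {1..n} \<Longrightarrow> interval_rep n (E i) (l i) (r i) (e i)" by metis
  moreover from this complete_exceptional_sequence_iff[of n E l r e]
  have "exceptional_intervals n (l(0 := 1)) (r(0 := Suc n))" using assms by blast
  ultimately show ?thesis using that by blast
qed

text \<open>The values at 0 are free so that this applies to overwritten endpoints as well as to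
  \<open>left\<close> and \<open>right\<close> themselves.\<close>

lemma support_less_iff_nested:
  assumes "\<And>i. i \<in> {1..n} \<Longrightarrow> interval_rep n (E i) (l i) (r i) (e i)"
    and "i \<in> {1..n}" "j \<in> {1..n}"
  shows "support_less n E i j \<longleftrightarrow> nested n (l(0 := x)) (r(0 := y)) i j"
  using interval_rep.support[OF assms(1)] assms(2,3) by (auto simp: support_less_def nested_def)

lemma forest_order_support_less:
  assumes "complete_exceptional_sequence n E"
  shows "forest_order {1..n} (support_less n E)"
proof -
  obtain l r e where rep: "\<And>i. i \<in> {1..n} \<Longrightarrow> interval_rep n (E i) (l i) (r i) (e i)"
    and "exceptional_intervals n (l(0 := 1)) (r(0 := Suc n))"
    using complete_exceptional_sequence_intervals[OF assms] by blast
  then interpret exceptional_intervals n "l(0 := 1)" "r(0 := Suc n)" by simp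
  have eq: "support_less n E i j \<longleftrightarrow> lt i j" if "i \<in> {1..n}" "j \<in> {1..n}" for i j
    using support_less_iff_nested[of n E l r e, OF rep that] .
  show ?thesis
    unfolding forest_order_def
  proof (intro conjI ballI impI)
    fix x assume "x \<in> {1..n}"
    then show "\<not> support_less n E x x" using eq lt_irrefl by blast
  next
    fix x y z assume V: "x \<in> {1..n}" "y \<in> {1..n}" "z \<in> {1..n}" and xy: "support_less n E x y"
    show "support_less n E x z" if "support_less n E y z"
      using V xy that eq lt_trans[of x y z] by simp
    show "y = z \<or> support_less n E y z \<or> support_less n E z y" if "support_less n E x z"
      using V xy that eq up_chain[of x y z] by simp
  qed simp
qed

lemma complete_exceptional_sequence_unique:
  assumes E: "complete_exceptional_sequence n E" and E': "complete_exceptional_sequence n E'"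
    and same: "\<And>i j. i \<in> {1..n} \<Longrightarrow> j \<in> {1..n} \<Longrightarrow> support_less n E i j \<longleftrightarrow> support_less n E' i j"
    and i: "i \<in> {1..n}"
  shows "isomorphic n (E' i) (E i)"
proof -
  obtain l r e where rep: "\<And>i. i \<in> {1..n} \<Longrightarrow> interval_rep n (E i) (l i) (r i) (e i)"
    and X: "exceptional_intervals n (l(0 := 1)) (r(0 := Suc n))"
    using complete_exceptional_sequence_intervals[OF E] by blast
  obtain l' r' e' where rep': "\<And>i. i \<in> {1..n} \<Longrightarrow> interval_rep n (E' i) (l' i) (r' i) (e' i)"
    and X': "exceptional_intervals n (l'(0 := 1)) (r'(0 := Suc n))"
    using complete_exceptional_sequence_intervals[OF E'] by blast
  interpret X: exceptional_intervals n "l(0 := 1)" "r(0 := Suc n)" by (rule X)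
  interpret X': exceptional_intervals n "l'(0 := 1)" "r'(0 := Suc n)" by (rule X')
  \<comment> \<open>The supports compare positive indices only; the relations with the root agree
    because it lies above all others in both families.\<close>
  have "X.lt u v \<longleftrightarrow> X'.lt u v" for u v
  proof (cases "u \<le> n \<and> v \<le> n")
    case le: True
    consider "u = 0" | "u \<noteq> 0" "v = 0" | "u \<in> {1..n}" "v \<in> {1..n}" using le by fastforce
    then show ?thesis
    proof cases
      case 1
      then show ?thesis
        using X.lt_0[of v] X.lt_asym[of 0 v] X.lt_irrefl X'.lt_0[of v] X'.lt_asym[of 0 v] X'.lt_irrefl le
        by (cases "v = 0") auto
    next
      case 2
      then show ?thesis using X.lt_0 X'.lt_0 le by blast
    next
      case 3
      show ?thesis
        using same[OF 3] support_less_iff_nested[of n E l r e, OF rep 3]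
          support_less_iff_nested[of n E' l' r' e', OF rep' 3] by blast
    qed
  next
    case False
    then show ?thesis using X.lt_bounded X'.lt_bounded by blast
  qed
  then have "X.lt = X'.lt" by (intro ext) blast
  from exceptional_intervals_unique[OF X X' this, of i]
  have "l' i = l i" "r' i = r i" using i by auto
  moreover have "two_interval_reps n (E' i) (E i) (l' i) (r' i) (l i) (r i) (e' i) (e i)"
    using rep[OF i] rep'[OF i] by (simp add: two_interval_reps_def)
  ultimately show ?thesis using two_interval_reps.isomorphic_if_eq by metis
qed

lemma forest_order_ex_complete_exceptional_sequence:
  assumes forest: "forest_order {1..n} lt"
  shows "\<exists>E :: nat \<Rightarrow> 'k::field rep. complete_exceptional_sequence n E \<and>
    (\<forall>i\<in>{1..n}. \<forall>j\<in>{1..n}. support_less n E i j \<longleftrightarrow> lt i j)"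
proof -
  define lt0 where "lt0 u v \<longleftrightarrow> u \<in> {1..n} \<and> (v = 0 \<or> v \<in> {1..n} \<and> lt u v)" for u v
  interpret tree_order n lt0
  proof
    show "\<not> lt0 u u" for u using forest_irrefl[OF forest] by (auto simp: lt0_def)
    show "lt0 u w" if "lt0 u v" "lt0 v w" for u v w
      using that forest_trans[OF forest, of u v w] by (auto simp: lt0_def)
    show "v = w \<or> lt0 v w \<or> lt0 w v" if "lt0 u v" "lt0 u w" for u v w
      using that forest_chain[OF forest, of u v w] by (auto simp: lt0_def)
  qed (auto simp: lt0_def)
  interpret X: exceptional_intervals n left right by (rule exceptional_intervals)
  let ?E = "\<lambda>i. interval_module (left i) (right i) :: 'k rep"
  have rep: "interval_rep n (?E i) (left i) (right i) (\<lambda>_. unit_vec 0)" if "i \<in> {1..n}" for i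
    using X.l_pos X.l_le_r X.r_le that by (intro interval_rep_interval_module) auto
  \<comment> \<open>The recipe itself assigns \<open>[1, n + 1]\<close> to the root, so overwriting
    at 0 has no effect.\<close>
  have upd: "left(0 := 1) = left" "right(0 := Suc n) = right"
    using X.l_0 X.r_0 by (auto simp: fun_eq_iff)
  have "complete_exceptional_sequence n ?E"
    using complete_exceptional_sequence_iff[of n ?E left right "\<lambda>_ _. unit_vec 0"] rep
      exceptional_intervals upd by simp
  moreover have "support_less n ?E i j \<longleftrightarrow> lt i j" if "i \<in> {1..n}" "j \<in> {1..n}" for i j
    using support_less_iff_nested[of n ?E left right "\<lambda>_ _. unit_vec 0" i j "left 0" "right 0"] rep that
      nested_left_right by (simp add: lt0_def)
  ultimately show ?thesis by blast
qed

lemma hasse_edges_cong: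
  assumes "\<And>x y. x \<in> V \<Longrightarrow> y \<in> V \<Longrightarrow> lt x y \<longleftrightarrow> lt' x y"
  shows "hasse_edges V lt = hasse_edges V lt'" "maximal_elements V lt = maximal_elements V lt'"
proof -
  have "covered_by V lt = covered_by V lt'"
    using assms by (auto simp: covered_by_def fun_eq_iff)
  then show "hasse_edges V lt = hasse_edges V lt'" by (simp add: hasse_edges_def)
  show "maximal_elements V lt = maximal_elements V lt'"
    using assms by (auto simp: maximal_elements_def)
qed

theorem theoremA1:
  fixes n :: nat
  assumes "n \<ge> 1"
  shows "(\<forall>E :: nat \<Rightarrow> 'k::field rep. complete_exceptional_sequence n E \<longrightarrow>
            rooted_forest {1..n} (hasse_edges {1..n} (support_less n E))
              (maximal_elements {1..n} (support_less n E))) \<and>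
         (\<forall>F R. rooted_forest {1..n} F R \<longrightarrow>
            (\<exists>E :: nat \<Rightarrow> 'k rep. complete_exceptional_sequence n E \<and> has_hasse_diagram n E F R \<and>
               (\<forall>E' :: nat \<Rightarrow> 'k rep.
                  complete_exceptional_sequence n E' \<and> has_hasse_diagram n E' F R \<longrightarrow>
                  (\<forall>i\<in>{1..n}. isomorphic n (E' i) (E i)))))"
proof (intro conjI allI impI)
  fix E :: "nat \<Rightarrow> 'k rep" assume "complete_exceptional_sequence n E"
  then show "rooted_forest {1..n} (hasse_edges {1..n} (support_less n E))
      (maximal_elements {1..n} (support_less n E))"
    by (intro hasse_edges_rooted_forest forest_order_support_less)
next
  fix F R assume "rooted_forest {1..n} F R"
  then obtain lt where lt: "forest_order {1..n} lt"
      "hasse_edges {1..n} lt = F" "maximal_elements {1..n} lt = R"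
    using rooted_forest_ex_order[of "{1..n}" F R] by auto
  obtain E :: "nat \<Rightarrow> 'k rep" where E: "complete_exceptional_sequence n E"
    and E_lt: "\<And>i j. i \<in> {1..n} \<Longrightarrow> j \<in> {1..n} \<Longrightarrow> support_less n E i j \<longleftrightarrow> lt i j"
    using forest_order_ex_complete_exceptional_sequence[OF lt(1)] by blast
  have diagram: "has_hasse_diagram n E F R"
    unfolding has_hasse_diagram_def using hasse_edges_cong[of "{1..n}", OF E_lt] lt by simp
  have "isomorphic n (E' i) (E i)"
    if E': "complete_exceptional_sequence n E'" "has_hasse_diagram n E' F R" and i: "i \<in> {1..n}"
    for E' :: "nat \<Rightarrow> 'k rep" and i
  proof (rule complete_exceptional_sequence_unique[OF E E'(1) _ i])
    fix i j assume "i \<in> {1..n}" "j \<in> {1..n}"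
    then show "support_less n E i j \<longleftrightarrow> support_less n E' i j"
      using forest_order_determined[OF forest_order_support_less[OF E] forest_order_support_less[OF E'(1)]]
        diagram E'(2) by (simp add: has_hasse_diagram_def)
  qed
  then show "\<exists>E :: nat \<Rightarrow> 'k rep. complete_exceptional_sequence n E \<and> has_hasse_diagram n E F R \<and>
      (\<forall>E' :: nat \<Rightarrow> 'k rep. complete_exceptional_sequence n E' \<and> has_hasse_diagram n E' F R \<longrightarrow>
        (\<forall>i\<in>{1..n}. isomorphic n (E' i) (E i)))"
    using E diagram by blast
qed

end
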